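(* Let $H$ be a complex separable infinite dimensional Hilbert space, and fix an orthonormal basis of $H$ with respect to which transposes $A\mapsto A^{tr}$ are taken. Let $\phi: B(H)\to B(H)$ be a *-semigroup endomorphism which is uniformly continuous on every commutative $C^*$-subalgebra of $B(H)$. Then $\phi$ can be written in the block-diagonal form $$\phi(A)=\mathrm{diag}\bigl(0,\ I,\ A,\ A,\ \ldots,\ (A^* )^{tr},\ (A^* )^{tr},\ \ldots\bigr)\qquad (A\in B(H)).$$ That is, there exist complex Hilbert spaces $K_0,K_1$ (possibly zero), countable index sets $\mathcal I,\mathcal J$ (finite or infinite, possibly empty), and a unitary operator $$U: K_0\oplus K_1\oplus\Bigl(\bigoplus_{i\in \mathcal I}H\Bigr)\oplus\Bigl(\bigoplus_{j\in \mathcal J}H\Bigr)\to H$$ such that for every $A\in B(H)$ $$\phi(A)=U\Bigl(0_{K_0}\oplus I_{K_1}\oplus\Bigl(\bigoplus_{i\in \mathcal I}A\Bigr)\oplus\Bigl(\bigoplus_{j\in \mathcal J}(A^* )^{tr}\Bigr)\Bigr)U^*.$$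
   Context: $B(H)$ denotes the algebra of all bounded linear operators on $H$. A *-semigroup endomorphism of $B(H)$ is a map $\phi:B(H)\to B(H)$ (no linearity, additivity, injectivity or surjectivity is assumed) satisfying $\phi(AB)=\phi(A)\phi(B)$ and $\phi(A^* )=\phi(A)^*$ for all $A,B\in B(H)$. Uniform continuity on a commutative $C^*$-subalgebra means that the restriction of $\phi$ to that subalgebra is uniformly continuous with respect to the operator norm. $A^{tr}$ denotes the transpose of $A$ with respect to the fixed orthonormal basis $(e_n)$, i.e. $\langle A^{tr}e_m,e_n\rangle=\langle Ae_n,e_m\rangle$ for all $m,n$; $(A^* )^{tr}$ is the transpose of the adjoint of $A$. All direct sums of Hilbert spaces are orthogonal (Hilbert space) direct sums. *)

theory Defs
  imports "HOL-Analysis.Analysis"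
begin

(* Complex Hilbert spaces. The norm comes from real_inner, whose real inner product is the real
   part of the complex one, so the norm is the one induced by cinner. The complex inner product
   is linear in its first argument. *)
class complex_hilbert_space = real_inner + banach +
  fixes scaleC :: "complex \<Rightarrow> 'a \<Rightarrow> 'a"  (infixr \<open>*\<^sub>C\<close> 75)
    and cinner :: "'a \<Rightarrow> 'a \<Rightarrow> complex"
  assumes scaleC_add_right: "c *\<^sub>C (x + y) = c *\<^sub>C x + c *\<^sub>C y"
    and scaleC_add_left: "(c + d) *\<^sub>C x = c *\<^sub>C x + d *\<^sub>C x"
    and scaleC_scaleC: "c *\<^sub>C (d *\<^sub>C x) = (c * d) *\<^sub>C x"
    and scaleC_one: "1 *\<^sub>C x = x"
    and scaleR_scaleC: "r *\<^sub>R x = complex_of_real r *\<^sub>C x"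
    and cinner_add_left: "cinner (x + y) z = cinner x z + cinner y z"
    and cinner_scaleC_left: "cinner (c *\<^sub>C x) y = c * cinner x y"
    and cinner_commute: "cinner x y = cnj (cinner y x)"
    and inner_eq_Re_cinner: "x \<bullet> y = Re (cinner x y)"

lemma cinner_self: "cinner x x = complex_of_real ((norm x)\<^sup>2)"
proof -
  have "Im (cinner x x) = 0"
    using arg_cong[OF cinner_commute[of x x], of Im] by simp
  then show ?thesis
    by (simp add: complex_eq_iff power2_norm_eq_inner inner_eq_Re_cinner)
qed

lemma norm_scaleC: "norm (c *\<^sub>C x) = cmod c * norm x"
proof -
  have "cinner (c *\<^sub>C x) (c *\<^sub>C x) = c * cnj (cinner (c *\<^sub>C x) x)"
    by (subst cinner_scaleC_left, subst (1) cinner_commute) simp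
  also have "\<dots> = complex_of_real ((cmod c)\<^sup>2) * cinner x x"
    by (simp add: cinner_scaleC_left cinner_self complex_norm_square flip: of_real_power)
  finally have "complex_of_real ((norm (c *\<^sub>C x))\<^sup>2) = complex_of_real ((cmod c * norm x)\<^sup>2)"
    by (simp add: cinner_self power_mult_distrib)
  then have "(norm (c *\<^sub>C x))\<^sup>2 = (cmod c * norm x)\<^sup>2"
    by (simp only: of_real_eq_iff)
  then show ?thesis
    by (rule power2_eq_imp_eq) simp_all
qed

lemma bounded_linear_scaleC: "bounded_linear ((*\<^sub>C) c)"
proof (rule bounded_linear_intro[where K = "cmod c"])
  show "c *\<^sub>C (r *\<^sub>R x) = r *\<^sub>R (c *\<^sub>C x)" for r and x :: 'a
    by (simp add: scaleR_scaleC scaleC_scaleC mult.commute)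
qed (simp_all add: scaleC_add_right norm_scaleC mult.commute)

global_interpretation complex_vector: vector_space "scaleC :: complex \<Rightarrow> 'a \<Rightarrow> 'a :: complex_hilbert_space"
  defines csubspace = complex_vector.subspace
    and cspan = complex_vector.span
  by unfold_locales (simp_all add: scaleC_add_right scaleC_add_left scaleC_scaleC scaleC_one)

definition infinite_dimensional :: "'a::complex_hilbert_space itself \<Rightarrow> bool" where
  "infinite_dimensional _ \<longleftrightarrow> \<not> (\<exists>B :: 'a set. finite B \<and> cspan B = UNIV)"

definition orthonormal_basis :: "(nat \<Rightarrow> 'a::complex_hilbert_space) \<Rightarrow> bool" where
  "orthonormal_basis e \<longleftrightarrow>
     (\<forall>m n. cinner (e m) (e n) = (if m = n then 1 else 0)) \<and> closure (cspan (range e)) = UNIV"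


(* B(H), as the set of complex-linear elements of the library type of bounded real-linear maps.
   The norm of that type is the operator norm. *)
definition BH :: "('a::complex_hilbert_space \<Rightarrow>\<^sub>L 'a) set" where
  "BH = {A. \<forall>c x. blinfun_apply A (c *\<^sub>C x) = c *\<^sub>C blinfun_apply A x}"

lift_definition op_scaleC ::
  "complex \<Rightarrow> ('a::complex_hilbert_space \<Rightarrow>\<^sub>L 'a) \<Rightarrow> ('a \<Rightarrow>\<^sub>L 'a)" is "\<lambda>c A x. c *\<^sub>C A x"
  by (rule bounded_linear_compose[OF bounded_linear_scaleC])

definition adj :: "('a::complex_hilbert_space \<Rightarrow>\<^sub>L 'a) \<Rightarrow> ('a \<Rightarrow>\<^sub>L 'a)" where
  "adj A = (THE B. B \<in> BH \<and>
     (\<forall>x y. cinner (blinfun_apply A x) y = cinner x (blinfun_apply B y)))"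

definition transp :: "(nat \<Rightarrow> 'a::complex_hilbert_space) \<Rightarrow> ('a \<Rightarrow>\<^sub>L 'a) \<Rightarrow> ('a \<Rightarrow>\<^sub>L 'a)" where
  "transp e A = (THE B. B \<in> BH \<and>
     (\<forall>m n. cinner (blinfun_apply B (e m)) (e n) = cinner (blinfun_apply A (e n)) (e m)))"

definition star_semigroup_endomorphism ::
  "(('a::complex_hilbert_space \<Rightarrow>\<^sub>L 'a) \<Rightarrow> ('a \<Rightarrow>\<^sub>L 'a)) \<Rightarrow> bool" where
  "star_semigroup_endomorphism \<phi> \<longleftrightarrow>
     (\<forall>A\<in>BH. \<phi> A \<in> BH) \<and>
     (\<forall>A\<in>BH. \<forall>B\<in>BH. \<phi> (A o\<^sub>L B) = \<phi> A o\<^sub>L \<phi> B) \<and>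
     (\<forall>A\<in>BH. \<phi> (adj A) = adj (\<phi> A))"

(* C*-subalgebras are not required to contain the identity operator. *)
definition commutative_Cstar_subalgebra :: "('a::complex_hilbert_space \<Rightarrow>\<^sub>L 'a) set \<Rightarrow> bool" where
  "commutative_Cstar_subalgebra \<A> \<longleftrightarrow>
     \<A> \<subseteq> BH \<and> 0 \<in> \<A> \<and>
     (\<forall>A\<in>\<A>. \<forall>B\<in>\<A>. A + B \<in> \<A>) \<and>
     (\<forall>c. \<forall>A\<in>\<A>. op_scaleC c A \<in> \<A>) \<and>
     (\<forall>A\<in>\<A>. \<forall>B\<in>\<A>. A o\<^sub>L B \<in> \<A>) \<and>
     (\<forall>A\<in>\<A>. adj A \<in> \<A>) \<and>
     closed \<A> \<and>
     (\<forall>A\<in>\<A>. \<forall>B\<in>\<A>. A o\<^sub>L B = B o\<^sub>L A)"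


(* The Hilbert space direct sum of a family of closed subspaces K i of H, indexed by i in X, as an
   external sum: its elements are square-summable families, extended by 0 outside X.
   An arbitrary Hilbert space K that is a summand in a decomposition of H embeds isometrically in H
   as a closed subspace, so taking the summands inside H is no loss of generality. *)
definition hsum :: "'i set \<Rightarrow> ('i \<Rightarrow> 'a::complex_hilbert_space set) \<Rightarrow> ('i \<Rightarrow> 'a) set" where
  "hsum X K = {x. (\<forall>i\<in>X. x i \<in> K i) \<and> (\<forall>i. i \<notin> X \<longrightarrow> x i = 0) \<and>
     (\<lambda>i. (norm (x i))\<^sup>2) summable_on X}"

definition hsum_inner :: "'i set \<Rightarrow> ('i \<Rightarrow> 'a::complex_hilbert_space) \<Rightarrow> ('i \<Rightarrow> 'a) \<Rightarrow> complex" where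
  "hsum_inner X x y = (\<Sum>\<^sub>\<infinity>i\<in>X. cinner (x i) (y i))"

definition hsum_unitary ::
  "'i set \<Rightarrow> ('i \<Rightarrow> 'a::complex_hilbert_space set) \<Rightarrow> (('i \<Rightarrow> 'a) \<Rightarrow> 'a) \<Rightarrow> bool" where
  "hsum_unitary X K U \<longleftrightarrow>
     (\<forall>x\<in>hsum X K. \<forall>y\<in>hsum X K. U (\<lambda>i. x i + y i) = U x + U y) \<and>
     (\<forall>c. \<forall>x\<in>hsum X K. U (\<lambda>i. c *\<^sub>C x i) = c *\<^sub>C U x) \<and>
     (\<forall>x\<in>hsum X K. \<forall>y\<in>hsum X K. cinner (U x) (U y) = hsum_inner X x y) \<and>
     U ` hsum X K = UNIV"

definition hsum_adj ::
  "'i set \<Rightarrow> ('i \<Rightarrow> 'a::complex_hilbert_space set) \<Rightarrow> (('i \<Rightarrow> 'a) \<Rightarrow> 'a) \<Rightarrow> 'a \<Rightarrow> ('i \<Rightarrow> 'a)" where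
  "hsum_adj X K U y = (THE x. x \<in> hsum X K \<and>
     (\<forall>z\<in>hsum X K. cinner (U z) y = hsum_inner X z x))"

datatype block = Zero_Block | Id_Block | Op_Block nat | Adj_Transp_Block nat

definition blocks :: "nat set \<Rightarrow> nat set \<Rightarrow> block set" where
  "blocks I J = {Zero_Block, Id_Block} \<union> Op_Block ` I \<union> Adj_Transp_Block ` J"

primrec block_space :: "'a set \<Rightarrow> 'a set \<Rightarrow> block \<Rightarrow> 'a set" where
  "block_space K0 K1 Zero_Block = K0"
| "block_space K0 K1 Id_Block = K1"
| "block_space K0 K1 (Op_Block i) = UNIV"
| "block_space K0 K1 (Adj_Transp_Block j) = UNIV"

definition block_diag ::
  "(nat \<Rightarrow> 'a::complex_hilbert_space) \<Rightarrow> ('a \<Rightarrow>\<^sub>L 'a) \<Rightarrow> (block \<Rightarrow> 'a) \<Rightarrow> (block \<Rightarrow> 'a)" where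
  "block_diag e A x = (\<lambda>b. case b of
       Zero_Block \<Rightarrow> 0
     | Id_Block \<Rightarrow> x Id_Block
     | Op_Block i \<Rightarrow> blinfun_apply A (x (Op_Block i))
     | Adj_Transp_Block j \<Rightarrow> blinfun_apply (transp e (adj A)) (x (Adj_Transp_Block j)))"

end

theory Submission
  imports Defs
begin

text \<open>
  Why the theorem holds. The projection \<open>\<phi> 0\<close> absorbs every \<open>\<phi> A\<close>. It is the identity block, and
  \<open>\<psi> A = \<phi> A - \<phi> 0\<close> is again a continuous star semigroup endomorphism, now with \<open>\<psi> 0 = 0\<close>
  (\<open>star_semigroup_minus_zero\<close>). The zero block is the kernel of \<open>\<phi> 1\<close>. It remains to show that
  \<open>\<psi>\<close> is a sum of copies of \<open>A\<close> and of \<open>(A\<^sup>*)\<^sup>t\<^sup>r\<close> on the range of \<open>\<psi> 1\<close>.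

  Let \<open>E i j\<close> be the matrix units of the basis. Their images are again matrix units, and since
  \<open>E i i A E j j\<close> is a multiple of \<open>E i j\<close>, the block of \<open>\<psi> A\<close> in position \<open>(i, j)\<close> is determined by the
  matrix entry \<open>a\<close> of \<open>A\<close> and by the operator \<open>N a = \<psi> (a E 0 0)\<close>. Three facts complete the argument.

  \<^item> \<open>\<psi>\<close> is additive on orthogonal projections (\<open>\<psi>_orthogonal_add\<close>). This is where uniform continuity
    enters: a defect of additivity would be multiplicative in both scalars of \<open>a P + b Q\<close> and
    vanish on the axes, like the product \<open>a b\<close>, which is not uniformly continuous.
  \<^item> Writing a sum of scalars as a row times a column, this makes \<open>N\<close> additive (\<open>N_add\<close>). By continuity it
    is real linear (\<open>N_eq\<close>), so \<open>N \<i>\<close> squares to minus the identity, and the range of \<open>\<psi> (E 0 0)\<close>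
    splits into vectors on which \<open>N a\<close> is the scalar \<open>a\<close> and vectors on which it is the conjugate of \<open>a\<close>.
  \<^item> The projections \<open>\<psi> (E i i)\<close> sum up to \<open>\<psi> 1\<close> (\<open>\<psi>_nondegenerate\<close>). Otherwise \<open>\<psi>\<close> would have a part that
    vanishes on finite matrices. Such a part needs a nonseparable space, because
    an uncountable family of isometries of the space has ranges with pairwise finite-dimensional
    intersections.

  Each vector \<open>f\<close> of an orthonormal basis of the two eigenspaces of \<open>N \<i>\<close> then spans a copy of the whole space,
  with basis \<open>\<psi> (E i 0) f\<close>, on which \<open>\<psi> A\<close> is \<open>A\<close> or the operator with the conjugate matrix
  (\<open>shift_intertwines\<close>), and these copies together fill the range of \<open>\<psi> 1\<close> (\<open>\<psi>_separating\<close>).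
\<close>

section \<open>The complex inner product\<close>

lemma cinner_zero_left [simp]: "cinner 0 x = 0"
  using cinner_add_left[of 0 0 x] by simp

lemma cinner_minus_left [simp]: "cinner (- x) y = - cinner x y"
  using cinner_add_left[of x "- x" y] by (simp add: add_eq_0_iff2)

lemma cinner_diff_left: "cinner (x - y) z = cinner x z - cinner y z"
  using cinner_add_left[of x "- y" z] by simp

lemma cinner_add_right: "cinner x (y + z) = cinner x y + cinner x z"
  by (metis cinner_add_left cinner_commute complex_cnj_add)

lemma cinner_zero_right [simp]: "cinner x 0 = 0"
  using cinner_add_right[of x 0 0] by simp

lemma cinner_minus_right [simp]: "cinner x (- y) = - cinner x y"
  using cinner_add_right[of x y "- y"] by (simp add: add_eq_0_iff2)

lemma cinner_diff_right: "cinner x (y - z) = cinner x y - cinner x z"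
  using cinner_add_right[of x y "- z"] by simp

lemma cinner_scaleC_right: "cinner x (c *\<^sub>C y) = cnj c * cinner x y"
  by (metis cinner_commute cinner_scaleC_left complex_cnj_mult)

lemma cinner_scaleR_left: "cinner (r *\<^sub>R x) y = of_real r * cinner x y"
  by (simp add: scaleR_scaleC cinner_scaleC_left)

lemma cinner_scaleR_right: "cinner x (r *\<^sub>R y) = of_real r * cinner x y"
  by (simp add: scaleR_scaleC cinner_scaleC_right)

lemma cinner_sum_left: "cinner (sum f F) y = (\<Sum>i\<in>F. cinner (f i) y)"
  by (induction F rule: infinite_finite_induct) (simp_all add: cinner_add_left)

lemma cinner_Cauchy_Schwarz: "cmod (cinner x y) \<le> norm x * norm y"
proof (cases "cinner x y = 0")
  case False
  define c where "c = cnj (cinner x y) / cmod (cinner x y)"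
  have "c * cinner x y = cmod (cinner x y)"
    using False complex_norm_square[of "cinner x y"]
    by (simp add: c_def field_simps power2_eq_square)
  then have "cmod (cinner x y) = (c *\<^sub>C x) \<bullet> y"
    by (simp add: inner_eq_Re_cinner cinner_scaleC_left)
  also have "\<dots> \<le> norm (c *\<^sub>C x) * norm y"
    by (rule norm_cauchy_schwarz)
  also have "norm (c *\<^sub>C x) = norm x"
    using False by (simp add: norm_scaleC c_def norm_divide)
  finally show ?thesis .
qed simp

lemma bounded_linear_cinner_left: "bounded_linear (\<lambda>x. cinner x y)"
  by (rule bounded_linear_intro[where K = "norm y"])
    (simp_all add: cinner_add_left cinner_scaleR_left scaleR_conv_of_real cinner_Cauchy_Schwarz)

lemma bounded_linear_cinner_right: "bounded_linear (\<lambda>y. cinner x y)"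
  by (rule bounded_linear_intro[where K = "norm x"])
    (use cinner_Cauchy_Schwarz[of x] in
      \<open>simp_all add: cinner_add_right cinner_scaleR_right scaleR_conv_of_real mult.commute\<close>)

lemma cinner_eqI: "(\<And>z. cinner x z = cinner y z) \<Longrightarrow> x = y"
proof -
  assume "\<And>z. cinner x z = cinner y z"
  then have "cinner (x - y) (x - y) = 0" by (simp add: cinner_diff_left)
  then show ?thesis by (simp add: cinner_self)
qed

lemma cinner_eq_0_commute: "cinner x y = 0 \<longleftrightarrow> cinner y x = 0"
  by (metis cinner_commute complex_cnj_zero)

lemma norm_eq_of_cinner: "cinner x x = cinner y y \<Longrightarrow> norm x = norm y"
  by (simp add: cinner_self flip: of_real_power)

section \<open>Orthogonal series\<close>

text \<open>By Pythagoras, the partial sums are Cauchy as soon as the sums of squared norms are.\<close>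
lemma orthogonal_summable:
  fixes v :: "'i \<Rightarrow> 'a::{real_inner,banach}"
  assumes orth: "\<And>i j. i \<in> X \<Longrightarrow> j \<in> X \<Longrightarrow> i \<noteq> j \<Longrightarrow> v i \<bullet> v j = 0"
    and sq: "(\<lambda>i. (norm (v i))\<^sup>2) summable_on X"
  shows "v summable_on X"
proof -
  have Pyth: "(norm (sum v F))\<^sup>2 = (\<Sum>i\<in>F. (norm (v i))\<^sup>2)" if "finite F" "F \<subseteq> X" for F
    using that orth
    by (intro norm_sum_Pythagorean) (auto simp: pairwise_def orthogonal_def subset_iff)
  let ?q = "\<lambda>i. (norm (v i))\<^sup>2"
  have "\<exists>P. eventually P (finite_subsets_at_top X) \<and>
      (\<forall>F G. P F \<and> P G \<longrightarrow> dist (sum v F) (sum v G) < r)" if "r > 0" for r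
  proof -
    have "0 < (r/2)\<^sup>2" using that by simp
    then obtain F where F: "finite F" "F \<subseteq> X" "dist (sum ?q F) (infsum ?q X) \<le> (r/2)\<^sup>2 / 2"
      using infsum_finite_approximation[OF sq, of "(r/2)\<^sup>2 / 2"] by auto
    have close: "norm (sum v G - sum v F) < r/2" if G: "finite G" "F \<subseteq> G" "G \<subseteq> X" for G
    proof -
      have "sum ?q G \<le> infsum ?q X"
        by (rule finite_sum_le_infsum[OF sq G(1,3)]) simp
      then have "sum ?q (G - F) \<le> (r/2)\<^sup>2 / 2"
        using F(3) G(1,2) finite_sum_le_infsum[OF sq F(1,2)]
        by (simp add: sum_diff dist_real_def)
      then have "(norm (sum v (G - F)))\<^sup>2 < (r/2)\<^sup>2"
        using Pyth[of "G - F"] G \<open>0 < (r/2)\<^sup>2\<close> by (smt (verit) Diff_subset finite_Diff field_sum_of_halves subset_trans)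
      then have "norm (sum v (G - F)) < r/2"
        by (rule power2_less_imp_less) (use \<open>r > 0\<close> in simp)
      then show ?thesis using F(1) G by (simp add: sum_diff)
    qed
    show ?thesis
    proof (intro exI[of _ "\<lambda>G. finite G \<and> F \<subseteq> G \<and> G \<subseteq> X"] conjI allI impI)
      show "\<forall>\<^sub>F G in finite_subsets_at_top X. finite G \<and> F \<subseteq> G \<and> G \<subseteq> X"
        using F by (auto simp: eventually_finite_subsets_at_top)
    next
      fix G G' assume "(finite G \<and> F \<subseteq> G \<and> G \<subseteq> X) \<and> (finite G' \<and> F \<subseteq> G' \<and> G' \<subseteq> X)"
      then have "norm (sum v G - sum v F) < r/2" "norm (sum v G' - sum v F) < r/2"
        using close by auto
      then show "dist (sum v G) (sum v G') < r"
        by (metis dist_norm dist_triangle_half_l)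
    qed
  qed
  then have "cauchy_filter (filtermap (sum v) (finite_subsets_at_top X))"
    by (simp add: cauchy_filter_metric_filtermap)
  moreover have "complete (UNIV::'a set)"
    by (meson Cauchy_convergent UNIV_I complete_def convergent_def)
  ultimately obtain s where "(sum v \<longlongrightarrow> s) (finite_subsets_at_top X)"
    using complete_uniform[where S=UNIV] by (force simp add: filterlim_def)
  then show ?thesis
    using summable_on_def has_sum_def by blast
qed

lemma bounded_sums_summable:
  fixes q :: "'i \<Rightarrow> real"
  assumes "\<And>i. i \<in> X \<Longrightarrow> q i \<ge> 0" "\<And>F. finite F \<Longrightarrow> F \<subseteq> X \<Longrightarrow> sum q F \<le> C"
  shows "q summable_on X" "infsum q X \<le> C"
proof -
  show "q summable_on X"
    by (rule nonneg_bdd_above_summable_on) (use assms in \<open>auto simp: bdd_above_def\<close>)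
  then show "infsum q X \<le> C"
    by (rule infsum_le_finite_sums) (use assms in auto)
qed

lemma cinner_infsum_left:
  "v summable_on X \<Longrightarrow> ((\<lambda>i. cinner (v i) y) has_sum cinner (infsum v X) y) X"
  by (rule has_sum_bounded_linear[OF bounded_linear_cinner_left]) simp

lemma cinner_infsum_right:
  "v summable_on X \<Longrightarrow> ((\<lambda>i. cinner y (v i)) has_sum cinner y (infsum v X)) X"
  by (rule has_sum_bounded_linear[OF bounded_linear_cinner_right]) simp

definition orthonormal :: "('i \<Rightarrow> 'a::complex_hilbert_space) \<Rightarrow> bool" where
  "orthonormal u \<longleftrightarrow> (\<forall>i j. cinner (u i) (u j) = (if i = j then 1 else 0))"

lemma orthonormal_norm: "orthonormal u \<Longrightarrow> norm (u i) = 1"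
  using cinner_self[of "u i"] norm_ge_zero[of "u i"] power2_eq_1_iff[of "norm (u i)"]
  by (simp add: orthonormal_def flip: of_real_power)

lemma norm_sum_orthonormal:
  assumes "orthonormal u" "finite F"
  shows "(norm (\<Sum>i\<in>F. c i *\<^sub>C u i))\<^sup>2 = (\<Sum>i\<in>F. (cmod (c i))\<^sup>2)"
proof -
  have "(norm (\<Sum>i\<in>F. c i *\<^sub>C u i))\<^sup>2 = (\<Sum>i\<in>F. (norm (c i *\<^sub>C u i))\<^sup>2)"
    using assms
    by (intro norm_sum_Pythagorean)
      (auto simp: pairwise_def orthogonal_def inner_eq_Re_cinner cinner_scaleC_left
        cinner_scaleC_right orthonormal_def)
  then show ?thesis using assms by (simp add: norm_scaleC orthonormal_norm)
qed

text \<open>Testing a bounded functional on the finite sum of its own coefficients bounds the coefficients.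
  For the functional \<open>cinner _ x\<close> this is Bessel's inequality.\<close>
lemma Bessel_functional:
  assumes u: "orthonormal u" and F: "finite F"
    and add: "\<And>x y. f (x + y) = f x + f y" and scale: "\<And>c x. f (c *\<^sub>C x) = c * f x"
    and bound: "\<And>x. cmod (f x) \<le> C * norm x"
  shows "(\<Sum>i\<in>F. (cmod (f (u i)))\<^sup>2) \<le> C\<^sup>2"
proof -
  define v where "v = (\<Sum>i\<in>F. cnj (f (u i)) *\<^sub>C u i)"
  have f0: "f 0 = 0" using add[of 0 0] by simp
  have fsum: "f (sum g F) = (\<Sum>i\<in>F. f (g i))" for g
    by (induction F rule: infinite_finite_induct) (simp_all add: add f0)
  have norm_v: "(norm v)\<^sup>2 = (\<Sum>i\<in>F. (cmod (f (u i)))\<^sup>2)"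
    unfolding v_def norm_sum_orthonormal[OF u F] by simp
  have "f v = (\<Sum>i\<in>F. complex_of_real ((cmod (f (u i)))\<^sup>2))"
    unfolding v_def fsum scale by (intro sum.cong refl) (metis complex_norm_square mult.commute)
  then have "f v = complex_of_real ((norm v)\<^sup>2)"
    by (simp add: norm_v)
  then have le: "(norm v)\<^sup>2 \<le> C * norm v"
    using bound[of v] by (simp del: of_real_power)
  have "norm v \<le> \<bar>C\<bar>"
  proof (cases "v = 0")
    case False
    then show ?thesis using le by (simp add: power2_eq_square)
  qed simp
  then have "(norm v)\<^sup>2 \<le> C\<^sup>2"
    by (metis abs_norm_cancel abs_le_square_iff)
  then show ?thesis by (simp add: norm_v)
qed

lemma Bessel:
  assumes "orthonormal u" "finite F"
  shows "(\<Sum>i\<in>F. (cmod (cinner x (u i)))\<^sup>2) \<le> (norm x)\<^sup>2"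
proof -
  have "(\<Sum>i\<in>F. (cmod (cinner (u i) x))\<^sup>2) \<le> (norm x)\<^sup>2"
    by (rule Bessel_functional[OF assms, where f = "\<lambda>y. cinner y x"])
      (simp_all add: cinner_add_left cinner_scaleC_left, metis cinner_Cauchy_Schwarz mult.commute)
  moreover have "cmod (cinner (u i) x) = cmod (cinner x (u i))" for i
    by (metis cinner_commute complex_mod_cnj)
  ultimately show ?thesis by simp
qed

lemma orthonormal_series:
  assumes u: "orthonormal u"
    and bound: "\<And>F. finite F \<Longrightarrow> (\<Sum>i\<in>F. (cmod (c i))\<^sup>2) \<le> C\<^sup>2" and C: "C \<ge> 0"
  shows "(\<lambda>i. c i *\<^sub>C u i) summable_on UNIV"
    and "cinner (\<Sum>\<^sub>\<infinity>i. c i *\<^sub>C u i) (u j) = c j"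
    and "norm (\<Sum>\<^sub>\<infinity>i. c i *\<^sub>C u i) \<le> C"
proof -
  let ?v = "\<lambda>i. c i *\<^sub>C u i"
  have sq: "(norm (?v i))\<^sup>2 = (cmod (c i))\<^sup>2" for i
    using orthonormal_norm[OF u] by (simp add: norm_scaleC)
  show sm: "?v summable_on UNIV"
  proof (rule orthogonal_summable)
    show "?v i \<bullet> ?v j = 0" if "i \<noteq> j" for i j
      using u that
      by (simp add: inner_eq_Re_cinner cinner_scaleC_left cinner_scaleC_right orthonormal_def)
    show "(\<lambda>i. (norm (?v i))\<^sup>2) summable_on UNIV"
      unfolding sq by (rule bounded_sums_summable) (use bound in auto)
  qed
  have "((\<lambda>i. cinner (?v i) (u j)) has_sum cinner (infsum ?v UNIV) (u j)) UNIV"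
    by (rule cinner_infsum_left[OF sm])
  moreover have "(\<lambda>i. cinner (?v i) (u j)) = (\<lambda>i. if i = j then c j else 0)"
    using u by (auto simp: cinner_scaleC_left orthonormal_def)
  moreover have "((\<lambda>i. if i = j then c j else 0) has_sum c j) UNIV"
    using has_sum_finite[of "{j}" "\<lambda>i. if i = j then c j else 0"]
    by (subst has_sum_cong_neutral[where T = "{j}" and g = "\<lambda>i. if i = j then c j else 0"]) auto
  ultimately show "cinner (infsum ?v UNIV) (u j) = c j"
    by (metis has_sum_unique)
  have "((\<lambda>F. norm (sum ?v F)) \<longlongrightarrow> norm (infsum ?v UNIV)) (finite_subsets_at_top UNIV)"
    by (intro tendsto_norm infsum_tendsto sm)
  moreover have "norm (sum ?v F) \<le> C" if "finite F" for F
    by (rule power2_le_imp_le[OF _ C]) (simp add: norm_sum_orthonormal[OF u that] bound[OF that])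
  then have "\<forall>\<^sub>F F in finite_subsets_at_top UNIV. norm (sum ?v F) \<le> C"
    by (intro eventually_finite_subsets_at_top_weakI)
  ultimately show "norm (infsum ?v UNIV) \<le> C"
    by (rule tendsto_upperbound) simp
qed

lemma orthonormal_series_operator:
  assumes u: "orthonormal u"
    and add: "\<And>x y i. c (x + y) i = c x i + c y i"
    and scale: "\<And>r x i. c (r *\<^sub>R x) i = of_real r * c x i"
    and bound: "\<And>x F. finite F \<Longrightarrow> (\<Sum>i\<in>F. (cmod (c x i))\<^sup>2) \<le> (norm x)\<^sup>2"
  obtains W where "bounded_linear W" "\<And>x. W x = (\<Sum>\<^sub>\<infinity>i. c x i *\<^sub>C u i)"
    "\<And>x j. cinner (W x) (u j) = c x j"
proof -
  note series = orthonormal_series[OF u bound norm_ge_zero]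
  have "bounded_linear (\<lambda>x. \<Sum>\<^sub>\<infinity>i. c x i *\<^sub>C u i)"
  proof (rule bounded_linear_intro[where K = 1])
    show "(\<Sum>\<^sub>\<infinity>i. c (x + y) i *\<^sub>C u i) = (\<Sum>\<^sub>\<infinity>i. c x i *\<^sub>C u i) + (\<Sum>\<^sub>\<infinity>i. c y i *\<^sub>C u i)" for x y
      by (simp add: add scaleC_add_left infsum_add series)
    show "(\<Sum>\<^sub>\<infinity>i. c (r *\<^sub>R x) i *\<^sub>C u i) = r *\<^sub>R (\<Sum>\<^sub>\<infinity>i. c x i *\<^sub>C u i)" for r x
    proof -
      have "c (r *\<^sub>R x) i *\<^sub>C u i = r *\<^sub>R (c x i *\<^sub>C u i)" for i
        by (simp add: scale scaleR_scaleC scaleC_scaleC)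
      then show ?thesis by (simp add: infsum_scaleR_right)
    qed
    show "norm (\<Sum>\<^sub>\<infinity>i. c x i *\<^sub>C u i) \<le> norm x * 1" for x
      using series(3) by simp
  qed
  then show ?thesis using that series(2) by blast
qed

section \<open>Bounded operators, adjoints and matrices\<close>

lemma BH_D: "A \<in> BH \<Longrightarrow> A (c *\<^sub>C x) = c *\<^sub>C A x"
  by (simp add: BH_def)

lemma BH_zero [simp]: "0 \<in> BH"
  by (simp add: BH_def)

lemma BH_id [simp]: "id_blinfun \<in> BH"
  by (simp add: BH_def)

lemma BH_add [simp]: "A \<in> BH \<Longrightarrow> B \<in> BH \<Longrightarrow> A + B \<in> BH"
  by (simp add: BH_def blinfun.add_left scaleC_add_right)

lemma BH_diff [simp]: "A \<in> BH \<Longrightarrow> B \<in> BH \<Longrightarrow> A - B \<in> BH"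
  by (simp add: BH_def blinfun.diff_left complex_vector.scale_right_diff_distrib)

lemma BH_compose [simp]: "A \<in> BH \<Longrightarrow> B \<in> BH \<Longrightarrow> A o\<^sub>L B \<in> BH"
  by (simp add: BH_def)

lemma BH_scaleC [simp]: "A \<in> BH \<Longrightarrow> op_scaleC c A \<in> BH"
  by (simp add: BH_def op_scaleC.rep_eq scaleC_scaleC mult.commute)

lemma BH_sum: "(\<And>i. i \<in> F \<Longrightarrow> A i \<in> BH) \<Longrightarrow> sum A F \<in> BH"
  by (induction F rule: infinite_finite_induct) auto

lemma compose_assoc: "(A o\<^sub>L B) o\<^sub>L C = A o\<^sub>L (B o\<^sub>L C)"
  by (rule blinfun_eqI) simp

lemma compose_id [simp]: "A o\<^sub>L id_blinfun = A" "id_blinfun o\<^sub>L A = A"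
  by (auto intro: blinfun_eqI)

lemmas compose_add_left = bounded_bilinear.add_left[OF bounded_bilinear_blinfun_compose]
lemmas compose_add_right = bounded_bilinear.add_right[OF bounded_bilinear_blinfun_compose]
lemmas compose_diff_left = bounded_bilinear.diff_left[OF bounded_bilinear_blinfun_compose]
lemmas compose_diff_right = bounded_bilinear.diff_right[OF bounded_bilinear_blinfun_compose]
lemmas compose_sum_left = bounded_bilinear.sum_left[OF bounded_bilinear_blinfun_compose]
lemmas compose_sum_right = bounded_bilinear.sum_right[OF bounded_bilinear_blinfun_compose]

lemma adjI:
  assumes "B \<in> BH" "\<And>x y. cinner (blinfun_apply A x) y = cinner x (blinfun_apply B y)"
  shows "adj A = B"
  unfolding adj_def
proof (rule the_equality)
  fix B' assume B': "B' \<in> BH \<and> (\<forall>x y. cinner (A x) y = cinner x (B' y))"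
  show "B' = B"
  proof (rule blinfun_eqI, rule cinner_eqI)
    show "cinner (B' y) z = cinner (B y) z" for y z
      using B' assms(2) by (metis cinner_commute)
  qed
qed (use assms in auto)

lemma adj_zero [simp]: "adj 0 = 0"
  by (rule adjI) auto

lemma adj_id [simp]: "adj id_blinfun = id_blinfun"
  by (rule adjI) auto

locale hilbert_basis =
  fixes e :: "nat \<Rightarrow> 'a::complex_hilbert_space"
  assumes onb: "orthonormal_basis e"
begin

lemma orthonormal_e: "orthonormal e"
  using onb by (simp add: orthonormal_basis_def orthonormal_def)

lemma cinner_e: "cinner (e i) (e j) = (if i = j then 1 else 0)"
  using orthonormal_e by (simp add: orthonormal_def)

lemma basis_dense:
  assumes "csubspace S" "closed S" "\<And>i. e i \<in> S"
  shows "x \<in> S"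
proof -
  have "cspan (range e) \<subseteq> S"
    using assms by (intro complex_vector.span_minimal) auto
  then have "closure (cspan (range e)) \<subseteq> S"
    using assms(2) by (rule closure_minimal)
  then show ?thesis using onb by (auto simp: orthonormal_basis_def)
qed

lemma eq_zero_if_coefficients:
  assumes "\<And>i. cinner x (e i) = 0"
  shows "x = 0"
proof -
  have "x \<in> {y. cinner x y = 0}"
  proof (rule basis_dense)
    show "closed {y. cinner x y = 0}"
      by (intro closed_Collect_eq continuous_intros
          linear_continuous_on[OF bounded_linear_cinner_right])
  qed (use assms in \<open>simp_all add: complex_vector.subspace_def cinner_add_right cinner_scaleC_right\<close>)
  then show ?thesis by (simp add: cinner_self)
qed

lemma eq_if_coefficients: "(\<And>i. cinner x (e i) = cinner y (e i)) \<Longrightarrow> x = y"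
  using eq_zero_if_coefficients[of "x - y"] by (simp add: cinner_diff_left)

lemma BH_eqI:
  assumes "A \<in> BH" "B \<in> BH" "\<And>i. blinfun_apply A (e i) = blinfun_apply B (e i)"
  shows "A = B"
proof (rule blinfun_eqI)
  fix x
  have "x \<in> {y. A y = B y}"
  proof (rule basis_dense)
    show "closed {y. A y = B y}"
      by (intro closed_Collect_eq continuous_intros)
  qed (use assms in \<open>simp_all add: complex_vector.subspace_def BH_D blinfun.add_right\<close>)
  then show "A x = B x" by simp
qed

lemma BH_eq_matrixI:
  assumes "A \<in> BH" "B \<in> BH"
    and "\<And>i j. cinner (blinfun_apply A (e i)) (e j) = cinner (blinfun_apply B (e i)) (e j)"
  shows "A = B"
  by (rule BH_eqI[OF assms(1,2)], rule eq_if_coefficients, rule assms(3))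

lemma Riesz_representation:
  fixes f :: "'a \<Rightarrow> complex"
  assumes add: "\<And>x y. f (x + y) = f x + f y" and scale: "\<And>c x. f (c *\<^sub>C x) = c * f x"
    and bound: "\<And>x. cmod (f x) \<le> C * norm x"
  shows "\<exists>w. \<forall>x. f x = cinner x w"
proof -
  have le: "(\<Sum>i\<in>F. (cmod (cnj (f (e i))))\<^sup>2) \<le> \<bar>C\<bar>\<^sup>2" if "finite F" for F
    using Bessel_functional[OF orthonormal_e that add scale bound] by simp
  define w where "w = (\<Sum>\<^sub>\<infinity>i. cnj (f (e i)) *\<^sub>C e i)"
  have w: "cinner (e i) w = f (e i)" for i
    using orthonormal_series(2)[OF orthonormal_e le abs_ge_zero, of i]
    by (simp add: w_def cinner_commute[of "e i"])
  have bl: "bounded_linear f"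
    by (rule bounded_linear_intro[where K = C])
      (use bound in \<open>simp_all add: add scaleR_scaleC scale scaleR_conv_of_real mult.commute\<close>)
  have "x \<in> {x. f x = cinner x w}" for x
  proof (rule basis_dense)
    show "closed {x. f x = cinner x w}"
      by (intro closed_Collect_eq linear_continuous_on[OF bl]
          linear_continuous_on[OF bounded_linear_cinner_left])
  qed (use w scale[of 0 0] in
      \<open>simp_all add: complex_vector.subspace_def add scale cinner_add_left cinner_scaleC_left\<close>)
  then show ?thesis by auto
qed

lemma adj_exists:
  fixes A :: "'a \<Rightarrow>\<^sub>L 'a"
  assumes A: "A \<in> BH"
  shows "\<exists>B\<in>BH. \<forall>x y. cinner (blinfun_apply A x) y = cinner x (blinfun_apply B y)"
proof -
  have "\<exists>w. \<forall>x. cinner (A x) y = cinner x w" for y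
  proof (rule Riesz_representation)
    have "cmod (cinner (A x) y) \<le> norm (A x) * norm y" for x
      by (rule cinner_Cauchy_Schwarz)
    also have "norm (A x) * norm y \<le> (norm A * norm x) * norm y" for x
      by (intro mult_right_mono norm_blinfun) simp
    finally show "cmod (cinner (A x) y) \<le> (norm A * norm y) * norm x" for x
      by (simp add: mult_ac)
  qed (simp_all add: blinfun.add_right cinner_add_left BH_D[OF A] cinner_scaleC_left)
  then obtain w where w: "cinner (A x) y = cinner x (w y)" for x y
    by metis
  have w': "cinner (w y) x = cinner y (A x)" for x y
    using w by (metis cinner_commute)
  have bl: "bounded_linear w"
  proof (rule bounded_linear_intro[where K = "norm A"])
    show "w (x + y) = w x + w y" for x y
      by (rule cinner_eqI) (simp add: cinner_add_left w')
    show "w (r *\<^sub>R y) = r *\<^sub>R w y" for r y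
      by (rule cinner_eqI) (simp add: cinner_scaleR_left w')
    show "norm (w y) \<le> norm y * norm A" for y
    proof (cases "w y = 0")
      case False
      have "(norm (w y))\<^sup>2 = cmod (cinner (A (w y)) y)"
        by (simp add: w cinner_self norm_power)
      also have "\<dots> \<le> norm (A (w y)) * norm y"
        by (rule cinner_Cauchy_Schwarz)
      also have "\<dots> \<le> (norm A * norm (w y)) * norm y"
        by (intro mult_right_mono norm_blinfun) simp
      finally show ?thesis
        using False by (simp add: power2_eq_square mult_ac)
    qed simp
  qed
  have "w (c *\<^sub>C y) = c *\<^sub>C w y" for c y
    by (rule cinner_eqI) (simp add: cinner_scaleC_left w')
  then have "Blinfun w \<in> BH"
    by (simp add: BH_def bounded_linear_Blinfun_apply[OF bl])
  then show ?thesis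
    by (auto simp: bounded_linear_Blinfun_apply[OF bl] w intro!: bexI[of _ "Blinfun w"])
qed

lemma
  fixes A :: "'a \<Rightarrow>\<^sub>L 'a"
  assumes "A \<in> BH"
  shows adj_BH [simp]: "adj A \<in> BH"
    and cinner_adj: "cinner (blinfun_apply A x) y = cinner x (blinfun_apply (adj A) y)"
proof -
  obtain B where "B \<in> BH" "\<forall>x y. cinner (A x) y = cinner x (B y)"
    using adj_exists[OF assms] by auto
  moreover from this have "adj A = B" by (intro adjI) auto
  ultimately show "adj A \<in> BH" "cinner (A x) y = cinner x (adj A y)" by auto
qed

lemma cinner_adj': "(A :: 'a \<Rightarrow>\<^sub>L 'a) \<in> BH \<Longrightarrow> cinner (blinfun_apply (adj A) x) y = cinner x (blinfun_apply A y)"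
  by (metis cinner_adj cinner_commute)

lemma adj_adj: "(A :: 'a \<Rightarrow>\<^sub>L 'a) \<in> BH \<Longrightarrow> adj (adj A) = A"
  by (rule adjI) (simp_all add: cinner_adj')

lemma adj_add: "(A :: 'a \<Rightarrow>\<^sub>L 'a) \<in> BH \<Longrightarrow> B \<in> BH \<Longrightarrow> adj (A + B) = adj A + adj B"
  by (rule adjI) (simp_all add: cinner_adj blinfun.add_left cinner_add_left cinner_add_right)

lemma adj_diff: "(A :: 'a \<Rightarrow>\<^sub>L 'a) \<in> BH \<Longrightarrow> B \<in> BH \<Longrightarrow> adj (A - B) = adj A - adj B"
  by (rule adjI) (simp_all add: cinner_adj blinfun.diff_left cinner_diff_left cinner_diff_right)

lemma adj_scaleC: "(A :: 'a \<Rightarrow>\<^sub>L 'a) \<in> BH \<Longrightarrow> adj (op_scaleC c A) = op_scaleC (cnj c) (adj A)"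
  by (rule adjI)
    (simp_all add: cinner_adj op_scaleC.rep_eq cinner_scaleC_left cinner_scaleC_right)

lemma adj_sum: "(\<And>i. i \<in> F \<Longrightarrow> (A i :: 'a \<Rightarrow>\<^sub>L 'a) \<in> BH) \<Longrightarrow> adj (sum A F) = (\<Sum>i\<in>F. adj (A i))"
  by (induction F rule: infinite_finite_induct) (simp_all add: adj_add BH_sum)

text \<open>For orthonormal \<open>u\<close> such an operator exists, is unique, and is an isometry onto the closed span of \<open>u\<close>.\<close>
definition carry :: "(nat \<Rightarrow> 'a) \<Rightarrow> 'a \<Rightarrow>\<^sub>L 'a" where
  "carry u = (SOME W. W \<in> BH \<and> (\<forall>i. blinfun_apply W (e i) = u i))"

lemma
  assumes u: "orthonormal u"
  shows carry_BH [simp]: "carry u \<in> BH" and carry_e: "blinfun_apply (carry u) (e i) = u i"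
proof -
  have "\<exists>W. W \<in> BH \<and> (\<forall>i. blinfun_apply W (e i) = u i)"
  proof (rule orthonormal_series_operator[OF u, where c = "\<lambda>x i. cinner x (e i)"])
    fix W :: "'a \<Rightarrow> 'a"
    assume W: "bounded_linear W" "\<And>x. W x = (\<Sum>\<^sub>\<infinity>i. cinner x (e i) *\<^sub>C u i)"
    have scale: "W (c *\<^sub>C x) = c *\<^sub>C W x" for c x
    proof -
      have sm: "(\<lambda>i. cinner x (e i) *\<^sub>C u i) summable_on UNIV"
        using orthonormal_series(1)[OF u Bessel[OF orthonormal_e] norm_ge_zero] .
      have "((\<lambda>i. c *\<^sub>C (cinner x (e i) *\<^sub>C u i)) has_sum (c *\<^sub>C W x)) UNIV"
        unfolding W(2) by (rule has_sum_bounded_linear[OF bounded_linear_scaleC]) (use sm in simp)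
      then show ?thesis
        by (simp add: W(2)[of "c *\<^sub>C x"] cinner_scaleC_left scaleC_scaleC infsumI)
    qed
    have "W (e i) = u i" for i
    proof -
      have "((\<lambda>j. cinner (e i) (e j) *\<^sub>C u j) has_sum u i) UNIV"
        using has_sum_finite[of "{i}" "\<lambda>j. cinner (e i) (e j) *\<^sub>C u j"]
        by (subst has_sum_cong_neutral[where T = "{i}"]) (auto simp: cinner_e scaleC_one)
      then show ?thesis by (simp add: W(2) infsumI)
    qed
    then show ?thesis
      using W(1) scale
      by (intro exI[of _ "Blinfun W"]) (simp add: BH_def bounded_linear_Blinfun_apply)
  qed (simp_all add: cinner_add_left cinner_scaleR_left Bessel[OF orthonormal_e])
  from someI_ex[OF this] show "carry u \<in> BH" "carry u (e i) = u i"
    by (simp_all add: carry_def)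
qed

lemma carry_isometry: "orthonormal u \<Longrightarrow> adj (carry u) o\<^sub>L carry u = id_blinfun"
  by (rule BH_eq_matrixI) (simp_all add: cinner_adj' carry_e cinner_e orthonormal_def)

text \<open>If \<open>A\<close> has matrix \<open>(a)\<close> then \<open>transp e (adj A)\<close> has the matrix with conjugate entries. It exists
  because it is \<open>C A C\<close> for the antilinear isometry \<open>C\<close> that fixes the basis; only the existence
  makes the definite description in \<open>transp\<close> meaningful.\<close>
lemma
  assumes A: "A \<in> BH"
  shows transp_adj_BH [simp]: "transp e (adj A) \<in> BH"
    and transp_adj_matrix: "cinner (blinfun_apply (transp e (adj A)) (e m)) (e n)
      = cnj (cinner (blinfun_apply A (e m)) (e n))"
proof -
  have flip: "cmod (cinner (e i) x) = cmod (cinner x (e i))" for i x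
    by (metis cinner_commute complex_mod_cnj)
  have "\<exists>C. bounded_linear C \<and> (\<forall>x j. cinner (C x) (e j) = cinner (e j) x)"
    by (rule orthonormal_series_operator[OF orthonormal_e, where c = "\<lambda>x i. cinner (e i) x"])
      (auto simp: cinner_add_right cinner_scaleR_right flip Bessel[OF orthonormal_e])
  then obtain C where C: "bounded_linear C" "\<And>x j. cinner (C x) (e j) = cinner (e j) x"
    by auto
  have C_scale: "C (c *\<^sub>C x) = cnj c *\<^sub>C C x" for c x
    by (rule eq_if_coefficients) (simp add: C cinner_scaleC_right cinner_scaleC_left)
  have C_e: "C (e m) = e m" for m
    by (rule eq_if_coefficients) (auto simp: C cinner_e)
  have bl: "bounded_linear (\<lambda>x. C (A (C x)))"
    by (intro bounded_linear_compose[OF C(1)] bounded_linear_compose[OF _ C(1)]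
        blinfun.bounded_linear_right)
  define B where "B = Blinfun (\<lambda>x. C (A (C x)))"
  have B_apply: "B x = C (A (C x))" for x
    by (simp add: B_def bounded_linear_Blinfun_apply[OF bl])
  have B: "B \<in> BH"
    by (simp add: BH_def B_apply C_scale BH_D[OF A])
  have mat: "cinner (B (e m)) (e n) = cnj (cinner (A (e m)) (e n))" for m n
    by (metis B_apply C(2) C_e cinner_commute)
  have adj_mat: "cinner (adj A (e n)) (e m) = cnj (cinner (A (e m)) (e n))" for m n
    using cinner_adj'[OF A] cinner_commute by metis
  have "transp e (adj A) = B"
    unfolding transp_def
  proof (rule the_equality)
    fix D assume "D \<in> BH \<and> (\<forall>m n. cinner (D (e m)) (e n) = cinner (adj A (e n)) (e m))"
    then show "D = B"
      by (intro BH_eq_matrixI) (simp_all add: B mat adj_mat)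
  qed (simp add: B mat adj_mat)
  then show "transp e (adj A) \<in> BH"
    "cinner (transp e (adj A) (e m)) (e n) = cnj (cinner (A (e m)) (e n))"
    by (simp_all add: B mat)
qed

subsection \<open>Matrix units\<close>

definition E :: "nat \<Rightarrow> nat \<Rightarrow> 'a \<Rightarrow>\<^sub>L 'a" where
  "E i j = Blinfun (\<lambda>x. cinner x (e j) *\<^sub>C e i)"

lemma E_apply: "blinfun_apply (E i j) x = cinner x (e j) *\<^sub>C e i"
proof -
  have "bounded_linear (\<lambda>x. cinner x (e j) *\<^sub>C e i)"
  proof (rule bounded_linear_intro[where K = 1])
    show "norm (cinner x (e j) *\<^sub>C e i) \<le> norm x * 1" for x
      using cinner_Cauchy_Schwarz[of x "e j"]
      by (simp add: norm_scaleC orthonormal_norm[OF orthonormal_e])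
  qed (simp_all add: cinner_add_left scaleC_add_left scaleR_scaleC scaleC_scaleC cinner_scaleC_left)
  then show ?thesis by (simp add: E_def bounded_linear_Blinfun_apply)
qed

lemma E_BH [simp]: "E i j \<in> BH"
  by (simp add: BH_def E_apply cinner_scaleC_left scaleC_scaleC)

lemma E_e: "blinfun_apply (E i j) (e k) = (if k = j then e i else 0)"
  by (simp add: E_apply cinner_e scaleC_one)

lemma adj_E [simp]: "adj (E i j) = E j i"
  by (rule adjI)
    (simp_all add: E_apply cinner_scaleC_left cinner_scaleC_right cinner_commute[of "e i"])

lemma E_compose: "E i j o\<^sub>L E k l = (if j = k then E i l else 0)"
  by (rule BH_eqI) (simp_all add: E_e)

lemma E_compress:
  "A \<in> BH \<Longrightarrow> E k i o\<^sub>L (A o\<^sub>L E j l) = op_scaleC (cinner (blinfun_apply A (e j)) (e i)) (E k l)"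
  by (rule BH_eqI) (simp_all add: E_e op_scaleC.rep_eq, simp add: E_apply)

end

section \<open>The algebra spanned by two orthogonal projections\<close>

lemma op_scaleC_one [simp]: "op_scaleC 1 A = A"
  by (rule blinfun_eqI) (simp add: op_scaleC.rep_eq scaleC_one)

lemma op_scaleC_zero [simp]: "op_scaleC 0 A = 0" "op_scaleC c 0 = 0"
  by (auto intro!: blinfun_eqI simp: op_scaleC.rep_eq)

lemma op_scaleC_add: "op_scaleC (a + b) A = op_scaleC a A + op_scaleC b A"
  by (rule blinfun_eqI) (simp add: op_scaleC.rep_eq scaleC_add_left blinfun.add_left)

lemma op_scaleC_add_right: "op_scaleC c (A + B) = op_scaleC c A + op_scaleC c B"
  by (rule blinfun_eqI) (simp add: op_scaleC.rep_eq scaleC_add_right blinfun.add_left)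

lemma op_scaleC_scaleC: "op_scaleC c (op_scaleC d A) = op_scaleC (c * d) A"
  by (rule blinfun_eqI) (simp add: op_scaleC.rep_eq scaleC_scaleC)

lemma op_scaleC_compose:
  "A \<in> BH \<Longrightarrow> op_scaleC c A o\<^sub>L op_scaleC d B = op_scaleC (c * d) (A o\<^sub>L B)"
  by (rule blinfun_eqI) (simp add: op_scaleC.rep_eq scaleC_scaleC BH_D)

lemma norm_op_scaleC: "norm (op_scaleC c A) \<le> cmod c * norm A"
  by (rule norm_blinfun_bound)
    (simp_all add: op_scaleC.rep_eq norm_scaleC mult.assoc mult_left_mono norm_blinfun)

lemma bounded_linear_op_scaleC: "bounded_linear (\<lambda>c. op_scaleC c A)"
proof (rule bounded_linear_intro[where K = "norm A"])
  show "op_scaleC (r *\<^sub>R c) A = r *\<^sub>R op_scaleC c A" for r c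
    by (rule blinfun_eqI)
      (simp add: op_scaleC.rep_eq scaleR_scaleC scaleC_scaleC scaleR_conv_of_real blinfun.scaleR_left)
qed (simp_all add: op_scaleC_add norm_op_scaleC)

definition orthogonal_projections ::
  "('a::complex_hilbert_space \<Rightarrow>\<^sub>L 'a) \<Rightarrow> ('a \<Rightarrow>\<^sub>L 'a) \<Rightarrow> bool" where
  "orthogonal_projections P Q \<longleftrightarrow> P \<in> BH \<and> Q \<in> BH \<and> P o\<^sub>L P = P \<and> Q o\<^sub>L Q = Q \<and>
    P o\<^sub>L Q = 0 \<and> Q o\<^sub>L P = 0 \<and> adj P = P \<and> adj Q = Q"

abbreviation plane ::
  "('a::complex_hilbert_space \<Rightarrow>\<^sub>L 'a) \<Rightarrow> ('a \<Rightarrow>\<^sub>L 'a) \<Rightarrow> complex \<Rightarrow> complex \<Rightarrow> ('a \<Rightarrow>\<^sub>L 'a)" where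
  "plane P Q a b \<equiv> op_scaleC a P + op_scaleC b Q"

lemma plane_compose:
  "orthogonal_projections P Q \<Longrightarrow> plane P Q a b o\<^sub>L plane P Q c d = plane P Q (a * c) (b * d)"
  by (simp add: orthogonal_projections_def compose_add_left compose_add_right op_scaleC_compose)

text \<open>The coefficient \<open>a\<close> of \<open>plane P Q a b\<close> is a vector state at a unit vector in the range
  of \<open>P\<close>, hence continuous. If \<open>P = 0\<close> both sides vanish.\<close>
lemma projection_coefficient:
  assumes "orthogonal_projections P Q"
  shows "\<exists>x. \<forall>a b. op_scaleC (cinner (blinfun_apply (plane P Q a b) x) x) P = op_scaleC a P"
proof (cases "P = 0")
  case False
  then obtain y where y: "P y \<noteq> 0" by (metis blinfun_eqI zero_blinfun.rep_eq)
  define x where "x = inverse (norm (P y)) *\<^sub>R P y"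
  have "P x = x" "Q x = 0" "norm x = 1"
    using assms y
    by (simp_all add: x_def blinfun.scaleR_right orthogonal_projections_def
        flip: blinfun_apply_blinfun_compose)
  then have "cinner (plane P Q a b x) x = a" for a b
    by (simp add: blinfun.add_left op_scaleC.rep_eq cinner_add_left cinner_scaleC_left cinner_self)
  then show ?thesis by (intro exI[of _ x]) simp
qed simp

text \<open>The only property that is not algebra is closedness: by \<open>projection_coefficient\<close> the algebra is the set
  of fixed points of a continuous map.\<close>
lemma (in hilbert_basis) plane_Cstar_subalgebra:
  fixes P :: "'a \<Rightarrow>\<^sub>L 'a"
  assumes PQ: "orthogonal_projections P Q"
  shows "commutative_Cstar_subalgebra {plane P Q a b | a b. True}" (is "commutative_Cstar_subalgebra ?A")
proof -
  have QP: "orthogonal_projections Q P" using PQ by (auto simp: orthogonal_projections_def)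
  obtain x where x: "\<And>a b. op_scaleC (cinner (plane P Q a b x) x) P = op_scaleC a P"
    using projection_coefficient[OF PQ] by blast
  obtain y where y: "\<And>b a. op_scaleC (cinner (plane Q P b a y) y) Q = op_scaleC b Q"
    using projection_coefficient[OF QP] by blast
  have "?A = {A. A = plane P Q (cinner (blinfun_apply A x) x) (cinner (blinfun_apply A y) y)}"
  proof (intro equalityI subsetI)
    fix A assume "A \<in> ?A"
    then obtain a b where "A = plane P Q a b" by auto
    moreover have "plane P Q a b = plane Q P b a" by (simp add: add.commute)
    ultimately show "A \<in> {A. A = plane P Q (cinner (blinfun_apply A x) x) (cinner (blinfun_apply A y) y)}"
      using x[of a b] y[of b a] by (metis (mono_tags, lifting) mem_Collect_eq)
  qed auto
  moreover have "closed {A. A = plane P Q (cinner (blinfun_apply A x) x) (cinner (blinfun_apply A y) y)}"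
  proof (intro closed_Collect_eq continuous_on_id continuous_on_add)
    have "continuous_on UNIV (\<lambda>A. op_scaleC (cinner (blinfun_apply A z) z) R)" for z and R :: "'a \<Rightarrow>\<^sub>L 'a"
      by (intro linear_continuous_on bounded_linear_compose[OF bounded_linear_op_scaleC]
          bounded_linear_compose[OF bounded_linear_cinner_left] blinfun.bounded_linear_left)
    then show "continuous_on UNIV (\<lambda>A. op_scaleC (cinner (blinfun_apply A x) x) P)"
      "continuous_on UNIV (\<lambda>A. op_scaleC (cinner (blinfun_apply A y) y) Q)" by auto
  qed
  ultimately have "closed ?A" by simp
  moreover have "\<exists>c d. plane P Q a b + plane P Q a' b' = plane P Q c d" for a b a' b'
    by (intro exI[of _ "a + a'"] exI[of _ "b + b'"]) (simp add: op_scaleC_add)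
  moreover have "\<exists>c d. op_scaleC z (plane P Q a b) = plane P Q c d" for a b z
    by (intro exI[of _ "z * a"] exI[of _ "z * b"]) (simp add: op_scaleC_add_right op_scaleC_scaleC)
  moreover have "\<exists>c d. adj (plane P Q a b) = plane P Q c d" for a b
    using PQ by (intro exI[of _ "cnj a"] exI[of _ "cnj b"])
      (simp add: orthogonal_projections_def adj_add adj_scaleC)
  moreover have "\<exists>a b. 0 = plane P Q a b"
    by (intro exI[of _ 0]) simp
  moreover have "plane P Q a b \<in> BH" for a b
    using PQ by (simp add: orthogonal_projections_def)
  moreover have "\<exists>c d. plane P Q a b o\<^sub>L plane P Q a' b' = plane P Q c d" for a b a' b'
    using plane_compose[OF PQ] by blast
  moreover have "(plane P Q a b o\<^sub>L plane P Q a' b') = (plane P Q a' b' o\<^sub>L plane P Q a b)" for a b a' b'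
    by (simp add: plane_compose[OF PQ] mult.commute)
  ultimately show ?thesis
    unfolding commutative_Cstar_subalgebra_def by auto
qed

section \<open>Star semigroup endomorphisms that vanish at zero\<close>

locale star_semigroup = hilbert_basis e for e :: "nat \<Rightarrow> 'a::complex_hilbert_space" +
  fixes \<psi> :: "('a \<Rightarrow>\<^sub>L 'a) \<Rightarrow> ('a \<Rightarrow>\<^sub>L 'a)"
  assumes separable: "separable_space (euclidean :: 'a topology)"
    and endo: "star_semigroup_endomorphism \<psi>"
    and \<psi>_zero [simp]: "\<psi> 0 = 0"
    and uniformly_continuous:
      "\<And>\<A>. commutative_Cstar_subalgebra \<A> \<Longrightarrow> uniformly_continuous_on \<A> \<psi>"
begin

lemma \<psi>_BH [simp]: "A \<in> BH \<Longrightarrow> \<psi> A \<in> BH"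
  and \<psi>_compose: "A \<in> BH \<Longrightarrow> B \<in> BH \<Longrightarrow> \<psi> A o\<^sub>L \<psi> B = \<psi> (A o\<^sub>L B)"
  and \<psi>_adj: "A \<in> BH \<Longrightarrow> adj (\<psi> A) = \<psi> (adj A)"
  using endo by (auto simp: star_semigroup_endomorphism_def)

lemma \<psi>_compose_apply:
  "A \<in> BH \<Longrightarrow> B \<in> BH \<Longrightarrow> blinfun_apply (\<psi> A) (blinfun_apply (\<psi> B) x) = blinfun_apply (\<psi> (A o\<^sub>L B)) x"
  by (simp flip: \<psi>_compose)

lemma cinner_\<psi>: "A \<in> BH \<Longrightarrow> B \<in> BH \<Longrightarrow>
  cinner (blinfun_apply (\<psi> A) x) (blinfun_apply (\<psi> B) y) = cinner (blinfun_apply (\<psi> (adj B o\<^sub>L A)) x) y"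
  by (metis BH_compose \<psi>_BH \<psi>_adj \<psi>_compose_apply adj_BH adj_adj cinner_adj')

text \<open>Let \<open>R = \<psi> (P + Q) - \<psi> P - \<psi> Q\<close> be the defect. On its range both \<open>\<psi> P\<close>
  and \<open>\<psi> Q\<close> vanish, so \<open>\<psi> (aP + bQ) R\<close>, written \<open>D a b\<close> below, is multiplicative in \<open>(a, b)\<close> and
  vanishes on the axes. Uniform continuity makes it small at \<open>(d, 1/d)\<close> and at \<open>(1/d, d)\<close> for small
  \<open>d\<close>, although the product of these two values is \<open>R\<close>. This is the step that excludes maps
  such as exterior powers.\<close>
lemma \<psi>_orthogonal_add:
  assumes PQ: "orthogonal_projections P Q"
  shows "\<psi> (P + Q) = \<psi> P + \<psi> Q"
proof -
  have BH: "P \<in> BH" "Q \<in> BH" using PQ by (auto simp: orthogonal_projections_def)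
  define G where "G a b = \<psi> (plane P Q a b)" for a b
  have G_mult: "G a b o\<^sub>L G c d = G (a * c) (b * d)" for a b c d
    using BH by (simp add: G_def \<psi>_compose plane_compose[OF PQ])
  have G_zero: "G 0 0 = 0" by (simp add: G_def)
  define D where "D a b = G a b - G a 0 - G 0 b" for a b
  have D_mult: "D a b o\<^sub>L D c d = D (a * c) (b * d)" for a b c d
    by (simp add: D_def compose_diff_left compose_diff_right G_mult G_zero)
  have "uniformly_continuous_on {plane P Q a b | a b. True} \<psi>"
    using PQ plane_Cstar_subalgebra uniformly_continuous by blast
  then have "\<exists>r>0. \<forall>A\<in>{plane P Q a b | a b. True}. \<forall>B\<in>{plane P Q a b | a b. True}.
      dist B A < r \<longrightarrow> dist (\<psi> B) (\<psi> A) < 1/4"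
    unfolding uniformly_continuous_on_def by (meson zero_less_divide_1_iff zero_less_numeral)
  then obtain r where r: "r > 0" and close:
    "\<And>a b a' b'. dist (plane P Q a' b') (plane P Q a b) < r \<Longrightarrow> dist (G a' b') (G a b) < 1/4"
    unfolding G_def by blast
  define d where "d = r / (norm P + norm Q + 1)"
  have pos: "norm P + norm Q + 1 > 0" by (simp add: add_nonneg_pos)
  have d: "d > 0" using r pos by (simp add: d_def)
  have small: "norm (op_scaleC (of_real d) X) < r" if "norm X < norm P + norm Q + 1" for X :: "'a \<Rightarrow>\<^sub>L 'a"
  proof -
    have "norm (op_scaleC (of_real d) X) \<le> d * norm X"
      using norm_op_scaleC[of "of_real d" X] d by simp
    also have "\<dots> < d * (norm P + norm Q + 1)"
      using d that by simp
    also have "\<dots> = r" using pos by (simp add: d_def)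
    finally show ?thesis .
  qed
  have "norm P < norm P + norm Q + 1" "norm Q < norm P + norm Q + 1"
    using norm_ge_zero[of P] norm_ge_zero[of Q] by linarith+
  note small' = small[OF this(1)] small[OF this(2)]
  have close1: "dist (G d b) (G 0 b) < 1/4" and close2: "dist (G b d) (G b 0) < 1/4" for b
    by (rule close, use small' in \<open>simp add: dist_norm\<close>)+
  have T1: "norm (D d b) \<le> norm (G d b - G 0 b) + norm (G d 0)" for b
    using norm_triangle_ineq4[of "G d b - G 0 b" "G d 0"] by (simp add: D_def algebra_simps)
  have D1: "norm (D d b) \<le> 1/2" for b
    using T1[of b] close1[of b] close1[of 0] by (simp add: dist_norm G_zero)
  have T2: "norm (D b d) \<le> norm (G b d - G b 0) + norm (G 0 d)" for b
    using norm_triangle_ineq4[of "G b d - G b 0" "G 0 d"] by (simp add: D_def algebra_simps)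
  have D2: "norm (D b d) \<le> 1/2" for b
    using T2[of b] close2[of b] close2[of 0] by (simp add: dist_norm G_zero)
  have "D 1 1 = D d (inverse d) o\<^sub>L D (inverse d) d"
    using d by (simp add: D_mult flip: of_real_inverse of_real_mult)
  then have "norm (D 1 1) \<le> norm (D d (inverse d)) * norm (D (inverse d) d)"
    by (simp add: norm_blinfun_compose)
  also have "\<dots> \<le> 1/2 * (1/2)"
    by (intro mult_mono D1 D2) simp_all
  finally have quarter: "norm (D 1 1) \<le> 1/4" by simp
  have "norm (D 1 1) \<le> norm (D 1 1) * norm (D 1 1)"
    using norm_blinfun_compose[of "D 1 1" "D 1 1"] by (simp add: D_mult)
  also have "\<dots> \<le> norm (D 1 1) * (1/4)"
    by (intro mult_left_mono quarter) simp
  finally have "D 1 1 = 0" by simp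
  then show ?thesis by (simp add: D_def G_def algebra_simps)
qed

lemma orthogonal_projections_E:
  assumes "n \<notin> F" "finite F"
  shows "orthogonal_projections (\<Sum>i\<in>F. E i i) (E n n)"
proof -
  have "(\<Sum>i\<in>F. E i i) o\<^sub>L E k l = (if k \<in> F then E k l else 0)" for k l
    using assms(2) by (simp add: compose_sum_left E_compose)
  moreover have "E n n o\<^sub>L (\<Sum>i\<in>F. E i i) = 0"
    using assms by (auto simp: compose_sum_right E_compose intro!: sum.neutral)
  ultimately show ?thesis
    using assms(1)
    by (auto simp: orthogonal_projections_def compose_sum_right E_compose adj_sum intro!: BH_sum sum.cong)
qed

lemma \<psi>_sum_E: "finite F \<Longrightarrow> \<psi> (\<Sum>i\<in>F. E i i) = (\<Sum>i\<in>F. \<psi> (E i i))"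
proof (induction F rule: finite_induct)
  case (insert n F)
  then show ?case
    using \<psi>_orthogonal_add[OF orthogonal_projections_E[of n F]] by (simp add: add.commute)
qed simp

text \<open>The map that \<open>\<psi>\<close> induces on scalars, acting on the range of \<open>\<psi> (E 0 0)\<close>.\<close>
definition N :: "complex \<Rightarrow> 'a \<Rightarrow>\<^sub>L 'a" where
  "N a = \<psi> (op_scaleC a (E 0 0))"

lemma N_BH [simp]: "N a \<in> BH"
  by (simp add: N_def)

lemma N_compose: "N a o\<^sub>L N b = N (a * b)"
  by (simp add: N_def \<psi>_compose op_scaleC_compose E_compose)

lemma adj_N: "adj (N a) = N (cnj a)"
  by (simp add: N_def \<psi>_adj adj_scaleC)

text \<open>A sum of scalars is a matrix product of a row and a column, and the identity between them
  is the sum of two orthogonal projections.\<close>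
lemma N_add: "N (a + b) = N a + N b"
proof -
  define X where "X = op_scaleC a (E 0 0) + E 0 1"
  define Y where "Y = E 0 0 + op_scaleC b (E 1 0)"
  have BH: "X \<in> BH" "Y \<in> BH" by (simp_all add: X_def Y_def)
  have scale_E: "op_scaleC c (E i j) o\<^sub>L E k l = op_scaleC c (E i j o\<^sub>L E k l)"
    "E i j o\<^sub>L op_scaleC c (E k l) = op_scaleC c (E i j o\<^sub>L E k l)" for c i j k l
    using op_scaleC_compose[of "E i j" c 1 "E k l"] op_scaleC_compose[of "E i j" 1 c "E k l"]
    by simp_all
  have scale_E2: "op_scaleC c (E i j) o\<^sub>L op_scaleC d (E k l) = op_scaleC (c * d) (E i j o\<^sub>L E k l)" for c d i j k l
    by (rule op_scaleC_compose) simp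
  note simps = X_def Y_def compose_add_left compose_add_right scale_E scale_E2 E_compose
  have XY: "X o\<^sub>L (E 0 0 o\<^sub>L Y) = op_scaleC a (E 0 0)" "X o\<^sub>L (E 1 1 o\<^sub>L Y) = op_scaleC b (E 0 0)"
    by (simp_all add: simps)
  then have sum: "X o\<^sub>L ((E 0 0 + E 1 1) o\<^sub>L Y) = op_scaleC (a + b) (E 0 0)"
    by (simp add: compose_add_left compose_add_right op_scaleC_add)
  have add: "\<psi> (E 0 0 + E 1 1) = \<psi> (E 0 0) + \<psi> (E 1 1)"
    using \<psi>_orthogonal_add[OF orthogonal_projections_E[of 1 "{0}"]] by simp
  have "N (a + b) = \<psi> X o\<^sub>L (\<psi> (E 0 0 + E 1 1) o\<^sub>L \<psi> Y)"
    unfolding N_def sum[symmetric] using BH by (simp add: \<psi>_compose)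
  also have "\<dots> = (\<psi> X o\<^sub>L (\<psi> (E 0 0) o\<^sub>L \<psi> Y)) + (\<psi> X o\<^sub>L (\<psi> (E 1 1) o\<^sub>L \<psi> Y))"
    unfolding add by (simp only: compose_add_left compose_add_right)
  also have "\<dots> = N a + N b"
    using BH XY by (simp add: \<psi>_compose N_def)
  finally show ?thesis .
qed

lemma continuous_N: "continuous_on UNIV N"
proof -
  have "orthogonal_projections (E 0 0) 0"
    by (simp add: orthogonal_projections_def E_compose)
  then have "uniformly_continuous_on {plane (E 0 0) 0 a b | a b. True} \<psi>"
    using plane_Cstar_subalgebra uniformly_continuous by blast
  then have "continuous_on {plane (E 0 0) 0 a b | a b. True} \<psi>"
    by (rule uniformly_continuous_imp_continuous)
  then show ?thesis
    unfolding N_def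
    by (rule continuous_on_compose2[OF _ linear_continuous_on[OF bounded_linear_op_scaleC]]) auto
qed

text \<open>An additive map is rational linear, and continuity extends this to the reals.\<close>
lemma N_real: "N (of_real t) = t *\<^sub>R N 1"
proof -
  have N0: "N 0 = 0" by (simp add: N_def)
  have N_nat: "N (of_nat n * a) = real n *\<^sub>R N a" for n a
    by (induction n) (simp_all add: N0 N_add algebra_simps)
  have N_minus: "N (- a) = - N a" for a
    using N_add[of a "- a"] by (simp add: N0 add_eq_0_iff2)
  have N_int: "N (of_int k * a) = of_int k *\<^sub>R N a" for k a
  proof (cases k)
    case (neg n)
    then show ?thesis using N_minus[of "of_nat (Suc n) * a"] N_nat[of "Suc n" a]
      by (simp del: of_nat_Suc)
  qed (simp add: N_nat)
  have closed: "closed {t. N (of_real t) = t *\<^sub>R N 1}"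
    by (intro closed_Collect_eq continuous_on_compose2[OF continuous_N] continuous_intros) auto
  have "\<rat> \<subseteq> {t. N (of_real t) = t *\<^sub>R N 1}"
  proof
    fix t :: real assume "t \<in> \<rat>"
    then obtain m n where t: "n > 0" "t = of_int m / of_int n"
      by (metis Rats_cases')
    have "of_int n *\<^sub>R N (of_real t) = N (of_int n * of_real t)"
      by (simp add: N_int)
    also have "of_int n * complex_of_real t = of_int m * 1"
      using t by simp
    also have "N (of_int m * 1) = of_int m *\<^sub>R N 1"
      by (rule N_int)
    also have "\<dots> = of_int n *\<^sub>R (t *\<^sub>R N 1)"
      using t by simp
    finally show "t \<in> {t. N (of_real t) = t *\<^sub>R N 1}"
      using t(1) by (simp only: mem_Collect_eq scaleR_left_imp_eq real_scaleR_def scaleR_cancel_left) simp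
  qed
  then have "closure \<rat> \<subseteq> {t. N (of_real t) = t *\<^sub>R N 1}"
    using closed by (rule closure_minimal)
  then show ?thesis by (auto simp: Rats_closure_real)
qed

text \<open>So \<open>N\<close> is determined by the projection \<open>N 1\<close> and by \<open>N \<i>\<close>, a skew-adjoint square root of \<open>- N 1\<close>.\<close>
lemma N_eq: "N a = Re a *\<^sub>R N 1 + Im a *\<^sub>R N \<i>"
proof -
  have "N (of_real t * \<i>) = t *\<^sub>R N \<i>" for t
    unfolding N_compose[symmetric] N_real
    by (metis N_compose bounded_bilinear.scaleR_left bounded_bilinear_blinfun_compose mult_1)
  then have "N (of_real (Re a) + of_real (Im a) * \<i>) = Re a *\<^sub>R N 1 + Im a *\<^sub>R N \<i>"
    by (simp add: N_add N_real)
  then show ?thesis by (metis complex_eq mult.commute)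
qed

end

section \<open>Separability\<close>

lemma countable_orthonormal_set:
  fixes S :: "'a::complex_hilbert_space set"
  assumes sep: "separable_space (euclidean :: 'a topology)"
    and S: "\<And>x y. x \<in> S \<Longrightarrow> y \<in> S \<Longrightarrow> cinner x y = (if x = y then 1 else 0)"
  shows "countable S"
proof -
  obtain C :: "'a set" where C: "countable C" "closure C = UNIV"
    using sep by (auto simp: separable_space_def)
  have "\<exists>c\<in>C. dist c x < 1/2" for x
    using C(2) closure_approachable[of x C] by (metis UNIV_I half_gt_zero zero_less_one)
  then obtain c where c: "\<And>x. c x \<in> C" "\<And>x. dist (c x) x < 1/2" by metis
  have "inj_on c S"
  proof (rule inj_onI, rule ccontr)
    fix x y assume xy: "x \<in> S" "y \<in> S" "c x = c y" "x \<noteq> y"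
    have "cinner (x - y) (x - y) = 2"
      using S xy by (simp add: cinner_diff_left cinner_diff_right)
    then have "complex_of_real ((norm (x - y))\<^sup>2) = 2"
      by (simp only: cinner_self)
    then have "(norm (x - y))\<^sup>2 = 2"
      by (metis of_real_eq_iff of_real_numeral)
    moreover have "norm (x - y) < 1"
      using c(2)[of x] c(2)[of y] xy(3) dist_triangle_half_r[of "c x" x 1 y] by (simp add: dist_norm)
    ultimately show False
      using power_le_one[of "norm (x - y)" 2] by simp
  qed
  then show ?thesis
    using C(1) c(1) by (metis countable_image_inj_on countable_subset image_subsetI)
qed

text \<open>The codes of the initial segments of \<open>b\<close>, in order of length. Distinct sequences have only
  finitely many initial segments in common, so the ranges of these injections form an uncountable almost
  disjoint family of infinite sets.\<close>
definition branch :: "(nat \<Rightarrow> bool) \<Rightarrow> nat \<Rightarrow> nat" where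
  "branch b n = to_nat (map b [0..<n])"

lemma branch_eq_iff: "branch b m = branch c n \<longleftrightarrow> m = n \<and> (\<forall>i<n. b i = c i)"
proof -
  have "branch b m = branch c n \<longleftrightarrow> map b [0..<m] = map c [0..<n]"
    by (simp add: branch_def)
  also have "\<dots> \<longleftrightarrow> m = n \<and> (\<forall>i<n. b i = c i)"
    by (auto simp: list_eq_iff_nth_eq)
  finally show ?thesis .
qed

lemma uncountable_branches: "uncountable (UNIV :: (nat \<Rightarrow> bool) set)"
proof
  assume "countable (UNIV :: (nat \<Rightarrow> bool) set)"
  then obtain f :: "nat \<Rightarrow> nat \<Rightarrow> bool" where "range f = UNIV"
    using uncountable_def by blast
  then obtain k where "f k = (\<lambda>n. \<not> f n n)" by (metis UNIV_I imageE)
  then show False by (metis (full_types))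
qed

context star_semigroup
begin

text \<open>If this fails, a unit vector \<open>x\<close> in the range of \<open>\<psi> 1\<close> is annihilated by all
  \<open>\<psi> (E i i)\<close>, hence by \<open>\<psi> A\<close> for every \<open>A\<close> that depends on finitely many coordinates. The isometries that
  shift the basis along two different branches have ranges with finite-dimensional intersection, so
  their images move \<open>x\<close> to orthogonal unit vectors: an uncountable orthonormal family.\<close>
lemma \<psi>_nondegenerate:
  assumes x: "blinfun_apply (\<psi> id_blinfun) x = x" "\<And>i. blinfun_apply (\<psi> (E i i)) x = 0"
  shows "x = 0"
proof (rule ccontr)
  assume "x \<noteq> 0"
  define u where "u = inverse (norm x) *\<^sub>R x"
  have u: "\<psi> id_blinfun u = u" "\<And>i. \<psi> (E i i) u = 0" "cinner u u = 1"
    using x \<open>x \<noteq> 0\<close> by (simp_all add: u_def blinfun.scaleR_right cinner_self)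
  define V where "V b = carry (\<lambda>n. e (branch b n))" for b
  have on: "orthonormal (\<lambda>n. e (branch b n))" for b
    by (auto simp: orthonormal_def cinner_e branch_eq_iff)
  have V_BH [simp]: "V b \<in> BH" and V_e: "V b (e n) = e (branch b n)" for b n
    by (simp_all add: V_def on carry_e)
  have orth: "cinner (\<psi> (V b) u) (\<psi> (V c) u) = (if b = c then 1 else 0)" for b c
  proof (cases "b = c")
    case True
    then show ?thesis
      using carry_isometry[OF on] u by (simp add: cinner_\<psi> V_def[symmetric])
  next
    case False
    then obtain k where k: "b k \<noteq> c k" by auto
    define P where "P = (\<Sum>i\<in>{..k}. E i i)"
    have P_BH: "P \<in> BH" by (simp add: P_def BH_sum)
    have P_e: "P (e n) = (if n \<le> k then e n else 0)" for n
      by (simp add: P_def blinfun.sum_left E_e)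
    have "adj (V c) o\<^sub>L V b = (adj (V c) o\<^sub>L V b) o\<^sub>L P"
    proof (rule BH_eq_matrixI)
      show "cinner ((adj (V c) o\<^sub>L V b) (e i)) (e j) = cinner (((adj (V c) o\<^sub>L V b) o\<^sub>L P) (e i)) (e j)" for i j
        using k by (auto simp: P_e cinner_adj' V_e cinner_e branch_eq_iff)
    qed (simp_all add: P_BH)
    then have "\<psi> (adj (V c) o\<^sub>L V b) u = \<psi> (adj (V c) o\<^sub>L V b) (\<psi> P u)"
      using P_BH by (simp add: \<psi>_compose_apply)
    also have "\<psi> P u = 0"
      by (simp add: P_def \<psi>_sum_E blinfun.sum_left u)
    finally show ?thesis
      using False by (simp add: cinner_\<psi>)
  qed
  have inj: "inj (\<lambda>b. \<psi> (V b) u)"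
    by (rule injI) (metis orth zero_neq_one)
  have "countable (range (\<lambda>b. \<psi> (V b) u))"
    by (rule countable_orthonormal_set[OF separable]) (auto simp: orth dest: injD[OF inj])
  then show False
    using inj uncountable_branches countable_image_inj_eq by blast
qed

end

section \<open>Copies of the space inside a star semigroup endomorphism\<close>

context star_semigroup
begin

lemma N_one: "N 1 = \<psi> (E 0 0)"
  by (simp add: N_def)

text \<open>For \<open>c = \<i>\<close> the operator \<open>N a\<close> is the scalar \<open>a\<close> on these vectors, for \<open>c = - \<i>\<close> it is the
  conjugate of \<open>a\<close>.\<close>
definition eigenvectors :: "complex \<Rightarrow> 'a set" where
  "eigenvectors c = {f. blinfun_apply (N 1) f = f \<and> blinfun_apply (N \<i>) f = c *\<^sub>C f}"

lemma N_eigenvector: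
  "f \<in> eigenvectors c \<Longrightarrow> blinfun_apply (N a) f = (of_real (Re a) + c * of_real (Im a)) *\<^sub>C f"
  by (subst N_eq)
    (simp add: eigenvectors_def blinfun.add_left blinfun.scaleR_left scaleR_scaleC scaleC_scaleC
      scaleC_add_left mult.commute)

lemma csubspace_eigenvectors: "csubspace (eigenvectors c)"
  by (auto simp: complex_vector.subspace_def eigenvectors_def blinfun.add_right scaleC_add_right
      BH_D[OF N_BH] scaleC_scaleC mult.commute)

lemma cinner_N_i: "cinner (blinfun_apply (N \<i>) x) y = - cinner x (blinfun_apply (N \<i>) y)"
proof -
  have "N (- \<i>) = - N \<i>" using N_eq[of "- \<i>"] by simp
  then show ?thesis by (simp add: cinner_adj adj_N blinfun.minus_left)
qed

lemma eigenvectors_orthogonal: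
  assumes "f \<in> eigenvectors \<i>" "g \<in> eigenvectors (- \<i>)"
  shows "cinner f g = 0"
  using cinner_N_i[of f g] assms
  by (simp add: eigenvectors_def cinner_scaleC_left cinner_scaleC_right)

definition shift :: "'a \<Rightarrow> 'a \<Rightarrow>\<^sub>L 'a" where
  "shift f = carry (\<lambda>i. blinfun_apply (\<psi> (E i 0)) f)"

lemma cinner_\<psi>_E:
  assumes "blinfun_apply (N 1) f = f"
  shows "cinner (blinfun_apply (\<psi> (E i 0)) f) (blinfun_apply (\<psi> (E j 0)) g)
    = (if i = j then cinner f g else 0)"
  using assms by (simp add: cinner_\<psi> E_compose flip: N_one)

context
  fixes f :: 'a
  assumes f: "blinfun_apply (N 1) f = f" "cinner f f = 1"
begin

lemma orthonormal_shift: "orthonormal (\<lambda>i. blinfun_apply (\<psi> (E i 0)) f)"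
  using f by (simp add: orthonormal_def cinner_\<psi>_E)

lemma shift_BH [simp]: "shift f \<in> BH"
  by (simp add: shift_def orthonormal_shift)

lemma shift_e: "blinfun_apply (shift f) (e i) = blinfun_apply (\<psi> (E i 0)) f"
  by (simp add: shift_def orthonormal_shift carry_e)

lemma shift_isometry: "cinner (blinfun_apply (shift f) x) (blinfun_apply (shift f) y) = cinner x y"
proof -
  have "(adj (shift f) o\<^sub>L shift f) x = x"
    using carry_isometry[OF orthonormal_shift] by (simp add: shift_def)
  then show ?thesis by (simp flip: cinner_adj')
qed

lemma \<psi>_id_shift: "\<psi> id_blinfun o\<^sub>L shift f = shift f"
  by (rule BH_eqI) (simp_all add: shift_e \<psi>_compose_apply)

lemma \<psi>_E_shift: "\<psi> (E i i) o\<^sub>L shift f = shift f o\<^sub>L E i i"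
  by (rule BH_eqI) (auto simp: shift_e \<psi>_compose_apply E_compose E_e)

end

lemma shift_orthogonal:
  assumes "blinfun_apply (N 1) f = f" "cinner f f = 1" "blinfun_apply (N 1) g = g" "cinner g g = 1"
    and "cinner f g = 0"
  shows "cinner (blinfun_apply (shift f) x) (blinfun_apply (shift g) y) = 0"
proof -
  have "adj (shift g) o\<^sub>L shift f = 0"
    by (rule BH_eq_matrixI) (use assms in \<open>simp_all add: cinner_adj' shift_e cinner_\<psi>_E\<close>)
  then have "adj (shift g) (shift f x) = 0"
    by (metis blinfun_apply_blinfun_compose zero_blinfun.rep_eq)
  then show ?thesis
    using assms by (metis cinner_adj' cinner_zero_left shift_BH)
qed

text \<open>The compression of \<open>\<psi> A\<close> by \<open>\<psi> (E i i)\<close> and \<open>\<psi> (E j j)\<close> depends on one matrix entry of \<open>A\<close>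
  only, and \<open>N\<close> of this entry acts on \<open>f\<close> as a scalar. So \<open>\<psi> A\<close> has a matrix of scalars along \<open>shift f\<close>.\<close>
lemma shift_intertwines:
  assumes f: "f \<in> eigenvectors c" "cinner f f = 1" and AB: "A \<in> BH" "B \<in> BH"
    and matrix: "\<And>i j. cinner (blinfun_apply B (e j)) (e i)
      = of_real (Re (cinner (blinfun_apply A (e j)) (e i)))
        + c * of_real (Im (cinner (blinfun_apply A (e j)) (e i)))"
  shows "\<psi> A o\<^sub>L shift f = shift f o\<^sub>L B"
proof (rule BH_eqI)
  have f1: "N 1 f = f" using f(1) by (simp add: eigenvectors_def)
  note [simp] = shift_BH[OF f1 f(2)] shift_e[OF f1 f(2)]
  show "(\<psi> A o\<^sub>L shift f) (e j) = (shift f o\<^sub>L B) (e j)" for j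
  proof -
    define z where "z = \<psi> A (\<psi> (E j 0) f) - shift f (B (e j))"
    have "\<psi> id_blinfun (shift f x) = shift f x" for x
      using \<psi>_id_shift[OF f1 f(2)] by (metis blinfun_apply_blinfun_compose)
    then have "\<psi> id_blinfun z = z"
      using AB by (simp add: z_def blinfun.diff_right \<psi>_compose_apply)
    moreover have "\<psi> (E i i) z = 0" for i
    proof -
      let ?a = "cinner (A (e j)) (e i)" and ?b = "cinner (B (e j)) (e i)"
      have "\<psi> (E i i) (\<psi> A (\<psi> (E j 0) f)) = \<psi> (op_scaleC ?a (E i 0)) f"
        using AB by (simp add: \<psi>_compose_apply E_compress compose_assoc)
      also have "op_scaleC ?a (E i 0) = E i 0 o\<^sub>L op_scaleC ?a (E 0 0)"
        using op_scaleC_compose[of "E i 0" 1 ?a "E 0 0"] by (simp add: E_compose)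
      also have "\<psi> (E i 0 o\<^sub>L op_scaleC ?a (E 0 0)) f = \<psi> (E i 0) (N ?a f)"
        by (simp add: N_def \<psi>_compose_apply)
      also have "N ?a f = ?b *\<^sub>C f"
        by (simp add: N_eigenvector[OF f(1)] matrix)
      also have "\<psi> (E i 0) (?b *\<^sub>C f) = shift f (E i i (B (e j)))"
        by (simp add: E_apply BH_D)
      also have "\<dots> = \<psi> (E i i) (shift f (B (e j)))"
        using \<psi>_E_shift[OF f1 f(2)] by (metis blinfun_apply_blinfun_compose)
      finally show ?thesis by (simp add: z_def blinfun.diff_right)
    qed
    ultimately have "z = 0" by (rule \<psi>_nondegenerate)
    then show ?thesis by (simp add: z_def)
  qed
qed (use f AB in \<open>simp_all add: eigenvectors_def\<close>)

text \<open>Since \<open>N \<i>\<close> squares to \<open>- 1\<close> on the range of \<open>\<psi> (E 0 0)\<close>, every vector \<open>w\<close> there is half the sum of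
  the eigenvectors \<open>w - \<i> N \<i> w\<close> and \<open>w + \<i> N \<i> w\<close>. Applied to \<open>w = \<psi> (E 0 i) y\<close>, this reduces the claim
  to \<open>\<psi>_nondegenerate\<close>.\<close>
lemma \<psi>_separating:
  assumes S: "S \<subseteq> eigenvectors \<i>" "\<And>x. x \<in> eigenvectors \<i> \<Longrightarrow> (\<And>s. s \<in> S \<Longrightarrow> cinner x s = 0) \<Longrightarrow> x = 0"
    and S': "S' \<subseteq> eigenvectors (- \<i>)"
      "\<And>x. x \<in> eigenvectors (- \<i>) \<Longrightarrow> (\<And>s. s \<in> S' \<Longrightarrow> cinner x s = 0) \<Longrightarrow> x = 0"
    and y: "blinfun_apply (\<psi> id_blinfun) y = y"
      "\<And>s i. s \<in> S \<union> S' \<Longrightarrow> cinner y (blinfun_apply (\<psi> (E i 0)) s) = 0"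
  shows "y = 0"
proof (rule \<psi>_nondegenerate[OF y(1)])
  fix i
  define w where "w = \<psi> (E 0 i) y"
  have w1: "N 1 w = w" by (simp add: w_def N_one \<psi>_compose_apply E_compose)
  have NN: "N a (N b x) = N (a * b) x" for a b x
    by (simp flip: N_compose)
  have Nm1: "N (- 1) w = - w"
    using N_eq[of "- 1"] w1 by (simp add: blinfun.minus_left)
  have w_orth: "cinner w s = 0" if "s \<in> S \<union> S'" for s
    using y(2)[OF that, of i] \<psi>_adj[of "E i 0"] cinner_adj'[of "\<psi> (E i 0)" y s] by (simp add: w_def)
  have Nw_orth: "cinner (N \<i> w) s = 0" if "s \<in> S \<union> S'" for s
  proof -
    have "\<exists>c. N \<i> s = c *\<^sub>C s" using that S(1) S'(1) unfolding eigenvectors_def by blast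
    then show ?thesis by (auto simp: cinner_N_i cinner_scaleC_right w_orth[OF that])
  qed
  have 1: "w - \<i> *\<^sub>C N \<i> w = 0"
  proof (rule S(2))
    show "w - \<i> *\<^sub>C N \<i> w \<in> eigenvectors \<i>"
      by (simp add: eigenvectors_def blinfun.diff_right BH_D w1 NN Nm1 complex_vector.scale_right_diff_distrib
          scaleC_scaleC complex_vector.scale_minus_right complex_vector.scale_minus_left scaleC_one)
  qed (simp add: cinner_diff_left cinner_scaleC_left w_orth Nw_orth)
  have 2: "w + \<i> *\<^sub>C N \<i> w = 0"
  proof (rule S'(2))
    show "w + \<i> *\<^sub>C N \<i> w \<in> eigenvectors (- \<i>)"
      by (simp add: eigenvectors_def blinfun.add_right BH_D w1 NN Nm1 scaleC_add_right
          scaleC_scaleC complex_vector.scale_minus_right complex_vector.scale_minus_left scaleC_one)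
  qed (simp add: cinner_add_left cinner_scaleC_left w_orth Nw_orth)
  have "2 *\<^sub>R w = (w - \<i> *\<^sub>C N \<i> w) + (w + \<i> *\<^sub>C N \<i> w)"
    by (simp add: scaleR_2)
  then have "w = 0" using 1 2 by simp
  then have "\<psi> (E i 0) w = 0" by simp
  then show "\<psi> (E i i) y = 0"
    by (simp add: w_def \<psi>_compose_apply E_compose)
qed

end

lemma maximal_orthonormal_set:
  fixes M :: "'a::complex_hilbert_space set"
  assumes M: "csubspace M"
  shows "\<exists>S\<subseteq>M. (\<forall>x\<in>S. \<forall>y\<in>S. cinner x y = (if x = y then 1 else 0)) \<and>
    (\<forall>x\<in>M. (\<forall>s\<in>S. cinner x s = 0) \<longrightarrow> x = 0)"
proof -
  define on where "on S \<longleftrightarrow> S \<subseteq> M \<and> (\<forall>x\<in>S. \<forall>y\<in>S. cinner x y = (if x = y then 1 else 0))" for S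
  have "\<exists>S\<in>Collect on. \<forall>X\<in>Collect on. S \<subseteq> X \<longrightarrow> X = S"
  proof (rule subset_Zorn')
    fix C assume C: "subset.chain (Collect on) C"
    have sub: "X \<in> C \<Longrightarrow> on X" and lin: "X \<in> C \<Longrightarrow> Y \<in> C \<Longrightarrow> X \<subseteq> Y \<or> Y \<subseteq> X" for X Y
      using C by (auto simp: subset.chain_def)
    have "cinner x y = (if x = y then 1 else 0)" if "x \<in> X" "X \<in> C" "y \<in> Y" "Y \<in> C" for x y X Y
    proof -
      have "on (X \<union> Y)"
        using lin[OF that(2,4)] sub that by (auto simp: sup_absorb1 sup_absorb2)
      then show ?thesis using that(1,3) by (simp add: on_def)
    qed
    then show "\<Union>C \<in> Collect on"
      using sub by (force simp: on_def)
  qed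
  then obtain S where S: "on S" "\<And>X. on X \<Longrightarrow> S \<subseteq> X \<Longrightarrow> X = S" by auto
  have "x = 0" if x: "x \<in> M" "\<forall>s\<in>S. cinner x s = 0" for x
  proof (rule ccontr)
    assume "x \<noteq> 0"
    define u where "u = complex_of_real (inverse (norm x)) *\<^sub>C x"
    have "norm u = 1" using \<open>x \<noteq> 0\<close> by (simp add: u_def norm_scaleC norm_inverse)
    then have "cinner u u = 1" by (simp add: cinner_self)
    then have u: "u \<in> M" "cinner u u = 1" "\<forall>s\<in>S. cinner u s = 0" "\<forall>s\<in>S. cinner s u = 0"
      using x \<open>x \<noteq> 0\<close> M
      by (auto simp: u_def complex_vector.subspace_def cinner_scaleC_left cinner_scaleC_right
          cinner_eq_0_commute)
    then have "on (insert u S)"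
      using S(1) by (auto simp: on_def)
    then have "u \<in> S" using S(2) by blast
    then show False using u by auto
  qed
  then show ?thesis
    using S(1) unfolding on_def by blast
qed

section \<open>Hilbert space direct sums\<close>

text \<open>Below, \<open>T i\<close> is a partial isometry with initial space \<open>K i\<close>, the ranges of the \<open>T i\<close> are pairwise
  orthogonal and their sum is dense. Then \<open>assemble X T\<close> is a unitary operator from the external sum onto the space, and
  \<open>block_components X T\<close> is its inverse, hence its adjoint.\<close>
definition assemble :: "'i set \<Rightarrow> ('i \<Rightarrow> 'a \<Rightarrow>\<^sub>L 'a) \<Rightarrow> ('i \<Rightarrow> 'a) \<Rightarrow> 'a::complex_hilbert_space" where
  "assemble X T x = (\<Sum>\<^sub>\<infinity>i\<in>X. blinfun_apply (T i) (x i))"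

definition block_components :: "'i set \<Rightarrow> ('i \<Rightarrow> 'a \<Rightarrow>\<^sub>L 'a) \<Rightarrow> 'a::complex_hilbert_space \<Rightarrow> 'i \<Rightarrow> 'a" where
  "block_components X T y = (\<lambda>i. if i \<in> X then blinfun_apply (adj (T i)) y else 0)"

context hilbert_basis
begin

context
  fixes X :: "'i set" and K :: "'i \<Rightarrow> 'a set" and T :: "'i \<Rightarrow> 'a \<Rightarrow>\<^sub>L 'a"
  assumes subspace: "\<And>i. i \<in> X \<Longrightarrow> csubspace (K i)"
    and T_BH: "\<And>i. i \<in> X \<Longrightarrow> T i \<in> BH"
    and adj_T: "\<And>i y. i \<in> X \<Longrightarrow> blinfun_apply (adj (T i)) y \<in> K i"
    and isometric: "\<And>i x y. i \<in> X \<Longrightarrow> x \<in> K i \<Longrightarrow> y \<in> K i \<Longrightarrow>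
      cinner (blinfun_apply (T i) x) (blinfun_apply (T i) y) = cinner x y"
    and orthogonal: "\<And>i j x y. i \<in> X \<Longrightarrow> j \<in> X \<Longrightarrow> i \<noteq> j \<Longrightarrow> x \<in> K i \<Longrightarrow> y \<in> K j \<Longrightarrow>
      cinner (blinfun_apply (T i) x) (blinfun_apply (T j) y) = 0"
    and total: "\<And>y. (\<And>i. i \<in> X \<Longrightarrow> blinfun_apply (adj (T i)) y = 0) \<Longrightarrow> y = 0"
begin

lemma hsum_D: "x \<in> hsum X K \<Longrightarrow> i \<in> X \<Longrightarrow> x i \<in> K i"
  by (simp add: hsum_def)

lemma norm_T: "i \<in> X \<Longrightarrow> x \<in> K i \<Longrightarrow> norm (blinfun_apply (T i) x) = norm x"
  by (rule norm_eq_of_cinner) (rule isometric)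

lemma assemble_summable:
  assumes x: "x \<in> hsum X K"
  shows "(\<lambda>i. blinfun_apply (T i) (x i)) summable_on X"
proof (rule orthogonal_summable)
  show "T i (x i) \<bullet> T j (x j) = 0" if "i \<in> X" "j \<in> X" "i \<noteq> j" for i j
    using that orthogonal hsum_D[OF x] by (simp add: inner_eq_Re_cinner)
  have "(\<lambda>i. (norm (x i))\<^sup>2) summable_on X" using x by (simp add: hsum_def)
  then show "(\<lambda>i. (norm (T i (x i)))\<^sup>2) summable_on X"
    by (rule summable_on_cong[THEN iffD2, rotated]) (simp add: norm_T hsum_D[OF x])
qed

lemma cinner_assemble:
  assumes x: "x \<in> hsum X K" and i: "i \<in> X" and k: "k \<in> K i"
  shows "cinner (blinfun_apply (T i) k) (assemble X T x) = cinner k (x i)"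
proof -
  have "((\<lambda>j. cinner (T i k) (T j (x j))) has_sum cinner (T i k) (assemble X T x)) X"
    unfolding assemble_def by (rule cinner_infsum_right[OF assemble_summable[OF x]])
  moreover have "((\<lambda>j. cinner (T i k) (T j (x j))) has_sum cinner k (x i)) X"
    using i isometric[OF i k hsum_D[OF x i]] orthogonal[OF i _ _ k hsum_D[OF x]]
      has_sum_finite[of "{i}" "\<lambda>j. cinner (T i k) (T j (x j))"]
    by (subst has_sum_cong_neutral[where T = "{i}"]) auto
  ultimately show ?thesis by (rule has_sum_unique)
qed

lemma components_assemble:
  assumes x: "x \<in> hsum X K"
  shows "block_components X T (assemble X T x) = x"
proof
  fix i
  show "block_components X T (assemble X T x) i = x i"
  proof (cases "i \<in> X")
    case True
    define d where "d = adj (T i) (assemble X T x) - x i"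
    have "d \<in> K i"
      unfolding d_def using complex_vector.subspace_diff[OF subspace[OF True]] adj_T[OF True] hsum_D[OF x True] by blast
    then have "cinner d d = 0"
      using cinner_assemble[OF x True] unfolding d_def
      by (simp add: cinner_diff_right cinner_adj[OF T_BH[OF True], symmetric])
    then show ?thesis using True by (simp add: block_components_def d_def cinner_self)
  next
    case False
    then show ?thesis using x by (simp add: block_components_def hsum_def)
  qed
qed

lemma components_hsum: "block_components X T y \<in> hsum X K"
proof -
  let ?x = "block_components X T y"
  have K: "?x i \<in> K i" if "i \<in> X" for i
    using that adj_T by (simp add: block_components_def)
  have "(\<Sum>i\<in>F. (norm (?x i))\<^sup>2) \<le> (norm y)\<^sup>2" if F: "finite F" "F \<subseteq> X" for F
  proof -
    define v where "v = (\<Sum>i\<in>F. T i (?x i))"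
    have "(norm v)\<^sup>2 = (\<Sum>i\<in>F. (norm (T i (?x i)))\<^sup>2)"
      unfolding v_def using F orthogonal K
      by (intro norm_sum_Pythagorean)
        (auto simp: pairwise_def orthogonal_def inner_eq_Re_cinner subset_iff)
    also have "\<dots> = (\<Sum>i\<in>F. (norm (?x i))\<^sup>2)"
      using F K by (intro sum.cong) (auto simp: norm_T subset_iff)
    finally have norm_v: "(norm v)\<^sup>2 = (\<Sum>i\<in>F. (norm (?x i))\<^sup>2)" .
    have "cinner v y = (\<Sum>i\<in>F. complex_of_real ((norm (?x i))\<^sup>2))"
      unfolding v_def cinner_sum_left
    proof (rule sum.cong)
      fix i assume "i \<in> F"
      then have "i \<in> X" using F by auto
      then show "cinner (T i (?x i)) y = complex_of_real ((norm (?x i))\<^sup>2)"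
        by (simp add: cinner_adj[OF T_BH] block_components_def cinner_self)
    qed simp
    then have "cinner v y = complex_of_real ((norm v)\<^sup>2)"
      by (simp add: norm_v)
    then have "(norm v)\<^sup>2 \<le> norm v * norm y"
      using cinner_Cauchy_Schwarz[of v y] by (simp add: norm_power)
    then have "norm v \<le> norm y"
      by (cases "v = 0") (simp_all add: power2_eq_square)
    then show ?thesis
      using norm_v by (metis norm_ge_zero power_mono)
  qed
  then have "(\<lambda>i. (norm (?x i))\<^sup>2) summable_on X"
    by (intro bounded_sums_summable) auto
  then show ?thesis using K by (simp add: hsum_def block_components_def)
qed

lemma assemble_components: "assemble X T (block_components X T y) = y"
proof -
  have "adj (T i) (y - assemble X T (block_components X T y)) = 0" if "i \<in> X" for i
    using that fun_cong[OF components_assemble[OF components_hsum[of y]], of i]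
    by (simp add: block_components_def[of X T] blinfun.diff_right)
  then show ?thesis using total[of "y - assemble X T (block_components X T y)"] by simp
qed

lemma cinner_assemble_assemble:
  assumes x: "x \<in> hsum X K" and y: "y \<in> hsum X K"
  shows "cinner (assemble X T x) (assemble X T y) = hsum_inner X x y"
proof -
  have "((\<lambda>i. cinner (T i (x i)) (assemble X T y)) has_sum cinner (assemble X T x) (assemble X T y)) X"
    unfolding assemble_def[of X T x] by (rule cinner_infsum_left[OF assemble_summable[OF x]])
  then have "cinner (assemble X T x) (assemble X T y) = (\<Sum>\<^sub>\<infinity>i\<in>X. cinner (T i (x i)) (assemble X T y))"
    by (simp add: infsumI)
  also have "\<dots> = hsum_inner X x y"
    unfolding hsum_inner_def
    by (rule infsum_cong) (simp add: cinner_assemble[OF y] hsum_D[OF x])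
  finally show ?thesis .
qed

lemma hsum_unitary_assemble: "hsum_unitary X K (assemble X T)"
  unfolding hsum_unitary_def
proof (intro conjI ballI allI)
  show "assemble X T (\<lambda>i. x i + y i) = assemble X T x + assemble X T y"
    if "x \<in> hsum X K" "y \<in> hsum X K" for x y
    using that by (simp add: assemble_def blinfun.add_right infsum_add assemble_summable)
  show "assemble X T (\<lambda>i. c *\<^sub>C x i) = c *\<^sub>C assemble X T x" if x: "x \<in> hsum X K" for c x
  proof -
    have "((\<lambda>i. c *\<^sub>C T i (x i)) has_sum c *\<^sub>C assemble X T x) X"
      unfolding assemble_def
      by (rule has_sum_bounded_linear[OF bounded_linear_scaleC]) (simp add: assemble_summable[OF x])
    moreover have "assemble X T (\<lambda>i. c *\<^sub>C x i) = (\<Sum>\<^sub>\<infinity>i\<in>X. c *\<^sub>C T i (x i))"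
      unfolding assemble_def by (rule infsum_cong) (simp add: BH_D T_BH)
    ultimately show ?thesis by (simp add: infsumI)
  qed
  show "assemble X T ` hsum X K = UNIV"
    using assemble_components components_hsum by (metis UNIV_eq_I imageI)
qed (rule cinner_assemble_assemble)

lemma hsum_adj_assemble: "hsum_adj X K (assemble X T) y = block_components X T y"
  unfolding hsum_adj_def
proof (rule the_equality)
  show "block_components X T y \<in> hsum X K \<and>
    (\<forall>z\<in>hsum X K. cinner (assemble X T z) y = hsum_inner X z (block_components X T y))"
    using cinner_assemble_assemble components_hsum assemble_components by metis
next
  fix x assume x: "x \<in> hsum X K \<and> (\<forall>z\<in>hsum X K. cinner (assemble X T z) y = hsum_inner X z x)"
  then have "cinner (assemble X T z) y = cinner (assemble X T z) (assemble X T x)" if "z \<in> hsum X K" for z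
    using that by (simp add: cinner_assemble_assemble)
  then have "cinner z y = cinner z (assemble X T x)" for z
    using assemble_components components_hsum by metis
  then have "y = assemble X T x"
    by (metis cinner_commute cinner_eqI)
  then show "x = block_components X T y" using x components_assemble by simp
qed

lemma assemble_block_action:
  assumes "\<And>i. i \<in> X \<Longrightarrow> blinfun_apply A (blinfun_apply (T i) (block_components X T y i)) = blinfun_apply (T i) (x i)"
  shows "blinfun_apply A y = assemble X T x"
proof -
  have "((\<lambda>i. T i (block_components X T y i)) has_sum y) X"
    using assemble_summable[OF components_hsum] assemble_components[of y]
    by (simp add: assemble_def has_sum_iff)
  then have "((\<lambda>i. A (T i (block_components X T y i))) has_sum A y) X"
    by (rule has_sum_bounded_linear[OF blinfun.bounded_linear_right])
  then have "A y = (\<Sum>\<^sub>\<infinity>i\<in>X. A (T i (block_components X T y i)))"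
    by (simp add: infsumI)
  also have "\<dots> = assemble X T x"
    unfolding assemble_def by (rule infsum_cong) (rule assms)
  finally show ?thesis .
qed

end

end

section \<open>The block decomposition\<close>

text \<open>The value of \<open>\<phi>\<close> at zero is a projection that absorbs every \<open>\<phi> A\<close>: it carries the identity
  block, and subtracting it keeps multiplicativity.\<close>
lemma (in hilbert_basis) star_semigroup_minus_zero:
  fixes \<phi> :: "('a \<Rightarrow>\<^sub>L 'a) \<Rightarrow> ('a \<Rightarrow>\<^sub>L 'a)"
  assumes separable: "separable_space (euclidean :: 'a topology)"
    and \<phi>: "star_semigroup_endomorphism \<phi>"
    and uc: "\<And>\<A>. commutative_Cstar_subalgebra \<A> \<Longrightarrow> uniformly_continuous_on \<A> \<phi>"
  shows "star_semigroup e (\<lambda>A. \<phi> A - \<phi> 0)"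
proof
  have BH: "\<And>A. A \<in> BH \<Longrightarrow> \<phi> A \<in> BH"
    and mult: "\<And>A B. A \<in> BH \<Longrightarrow> B \<in> BH \<Longrightarrow> \<phi> (A o\<^sub>L B) = \<phi> A o\<^sub>L \<phi> B"
    and adj: "\<And>A. A \<in> BH \<Longrightarrow> \<phi> (adj A) = adj (\<phi> A)"
    using \<phi> by (auto simp: star_semigroup_endomorphism_def)
  have zero: "\<phi> A o\<^sub>L \<phi> 0 = \<phi> 0" "\<phi> 0 o\<^sub>L \<phi> A = \<phi> 0" if "A \<in> BH" for A
    using that by (simp_all flip: mult)
  have adj_zero_image: "adj (\<phi> 0) = \<phi> 0"
    using adj[OF BH_zero] by simp
  show "star_semigroup_endomorphism (\<lambda>A. \<phi> A - \<phi> 0)"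
    unfolding star_semigroup_endomorphism_def
    by (simp add: BH mult adj adj_diff adj_zero_image compose_diff_left compose_diff_right zero)
  show "uniformly_continuous_on \<A> (\<lambda>A. \<phi> A - \<phi> 0)" if "commutative_Cstar_subalgebra \<A>" for \<A>
    using uc[OF that] by (intro uniformly_continuous_on_diff uniformly_continuous_on_const)
qed (use separable in simp_all)

theorem mainTheorem1:
  fixes e :: "nat \<Rightarrow> 'a::complex_hilbert_space"
    and \<phi> :: "('a \<Rightarrow>\<^sub>L 'a) \<Rightarrow> ('a \<Rightarrow>\<^sub>L 'a)"
  assumes "separable_space (euclidean :: 'a topology)"
    and "infinite_dimensional TYPE('a)"
    and "orthonormal_basis e"
    and "star_semigroup_endomorphism \<phi>"
    and "\<And>\<A>. commutative_Cstar_subalgebra \<A> \<Longrightarrow> uniformly_continuous_on \<A> \<phi>"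
  shows "\<exists>(K0 :: 'a set) (K1 :: 'a set) (I :: nat set) (J :: nat set) (U :: (block \<Rightarrow> 'a) \<Rightarrow> 'a).
    csubspace K0 \<and> closed K0 \<and> csubspace K1 \<and> closed K1 \<and>
    hsum_unitary (blocks I J) (block_space K0 K1) U \<and>
    (\<forall>A\<in>BH. \<forall>y. blinfun_apply (\<phi> A) y =
      U (block_diag e A (hsum_adj (blocks I J) (block_space K0 K1) U y)))"
proof -
  interpret hilbert_basis e by unfold_locales (rule assms(3))
  define \<psi> where "\<psi> A = \<phi> A - \<phi> 0" for A
  interpret star_semigroup e \<psi>
    unfolding \<psi>_def by (rule star_semigroup_minus_zero[OF assms(1,4,5)])
  define \<phi>0 where "\<phi>0 = \<phi> 0"
  define \<phi>1 where "\<phi>1 = \<phi> id_blinfun"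
  have \<phi>_BH [simp]: "\<And>A. A \<in> BH \<Longrightarrow> \<phi> A \<in> BH"
    and \<phi>_mult: "\<And>A B. A \<in> BH \<Longrightarrow> B \<in> BH \<Longrightarrow> \<phi> (A o\<^sub>L B) = \<phi> A o\<^sub>L \<phi> B"
    and \<phi>_adj: "\<And>A. A \<in> BH \<Longrightarrow> \<phi> (adj A) = adj (\<phi> A)"
    using assms(4) by (auto simp: star_semigroup_endomorphism_def)
  have BH01 [simp]: "\<phi>0 \<in> BH" "\<phi>1 \<in> BH" by (simp_all add: \<phi>0_def \<phi>1_def)
  have adj01: "adj \<phi>0 = \<phi>0" "adj \<phi>1 = \<phi>1"
    by (simp_all add: \<phi>0_def \<phi>1_def flip: \<phi>_adj)
  have \<phi>_apply: "\<phi> A (\<phi> B x) = \<phi> (A o\<^sub>L B) x" if "A \<in> BH" "B \<in> BH" for A B x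
    using that by (simp add: \<phi>_mult)
  have \<phi>\<phi>0: "\<phi> A (\<phi>0 x) = \<phi>0 x" if "A \<in> BH" for A x
    using that by (simp add: \<phi>0_def \<phi>_apply)
  have \<phi>\<phi>1: "\<phi> A (\<phi>1 x) = \<phi> A x" if "A \<in> BH" for A x
    using that by (simp add: \<phi>1_def \<phi>_apply)
  have idem: "\<phi>0 (\<phi>0 x) = \<phi>0 x" "\<phi>0 (\<phi>1 x) = \<phi>0 x" "\<phi>1 (\<phi>0 x) = \<phi>0 x" "\<phi>1 (\<phi>1 x) = \<phi>1 x" for x
    using \<phi>\<phi>0[of 0] \<phi>\<phi>0[of id_blinfun] \<phi>\<phi>1[of 0] \<phi>\<phi>1[of id_blinfun]
    by (simp_all add: \<phi>0_def[symmetric] \<phi>1_def[symmetric])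
  have \<psi>_apply: "\<psi> A x = \<phi> A x - \<phi>0 x" for A x
    by (simp add: \<psi>_def \<phi>0_def blinfun.diff_left)

  define K0 where "K0 = {x. \<phi>1 x = 0}"
  define K1 where "K1 = {x. \<phi>0 x = x}"
  have lin: "\<phi>0 (c *\<^sub>C x) = c *\<^sub>C \<phi>0 x" "\<phi>1 (c *\<^sub>C x) = c *\<^sub>C \<phi>1 x" for c x
    by (rule BH_D, rule BH01)+
  have "csubspace K0"
    by (rule complex_vector.subspaceI) (simp_all add: K0_def blinfun.add_right lin)
  moreover have "csubspace K1"
    by (rule complex_vector.subspaceI) (simp_all add: K1_def blinfun.add_right lin)
  moreover have "closed K0" "closed K1"
    unfolding K0_def K1_def
    by (intro closed_Collect_eq linear_continuous_on blinfun.bounded_linear_right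
        continuous_on_const continuous_on_id)+
  ultimately have K: "csubspace K0" "closed K0" "csubspace K1" "closed K1" by auto

  define maximal where "maximal c h A \<longleftrightarrow> h ` A \<subseteq> eigenvectors c \<and>
    (\<forall>i\<in>A. \<forall>j\<in>A. cinner (h i) (h j) = (if i = j then 1 else 0)) \<and>
    (\<forall>x\<in>eigenvectors c. (\<forall>i\<in>A. cinner x (h i) = 0) \<longrightarrow> x = 0)"
    for c and h :: "nat \<Rightarrow> 'a" and A
  have bases: "\<exists>h A. maximal c h A" for c
  proof -
    obtain S where S: "S \<subseteq> eigenvectors c"
      "\<And>x y. x \<in> S \<Longrightarrow> y \<in> S \<Longrightarrow> cinner x y = (if x = y then 1 else 0)"
      "\<forall>x\<in>eigenvectors c. (\<forall>s\<in>S. cinner x s = 0) \<longrightarrow> x = 0"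
      using maximal_orthonormal_set[OF csubspace_eigenvectors[of c]] by auto
    have "countable S"
      by (rule countable_orthonormal_set[OF assms(1) S(2)])
    then obtain f :: "nat \<Rightarrow> 'a" and I where f: "bij_betw f I S"
      by (rule countableE_bij)
    then have img: "f ` I = S" and inj: "inj_on f I" by (auto simp: bij_betw_def)
    show ?thesis
      unfolding maximal_def
    proof (intro exI[of _ f] exI[of _ I] conjI ballI impI)
      show "f ` I \<subseteq> eigenvectors c" using S(1) img by simp
      show "cinner (f i) (f j) = (if i = j then 1 else 0)" if "i \<in> I" "j \<in> I" for i j
        using S(2)[of "f i" "f j"] that img inj_on_eq_iff[OF inj that] by (metis imageI)
      show "x = 0" if "x \<in> eigenvectors c" "\<forall>i\<in>I. cinner x (f i) = 0" for x
        using S(3) that img by (metis imageE)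
    qed
  qed
  obtain f I where "maximal \<i> f I" using bases by metis
  then have f: "f ` I \<subseteq> eigenvectors \<i>"
      "\<And>i j. i \<in> I \<Longrightarrow> j \<in> I \<Longrightarrow> cinner (f i) (f j) = (if i = j then 1 else 0)"
      "\<And>x. x \<in> eigenvectors \<i> \<Longrightarrow> (\<And>i. i \<in> I \<Longrightarrow> cinner x (f i) = 0) \<Longrightarrow> x = 0"
    unfolding maximal_def by simp_all
  obtain g J where "maximal (- \<i>) g J" using bases by metis
  then have g: "g ` J \<subseteq> eigenvectors (- \<i>)"
      "\<And>i j. i \<in> J \<Longrightarrow> j \<in> J \<Longrightarrow> cinner (g i) (g j) = (if i = j then 1 else 0)"
      "\<And>x. x \<in> eigenvectors (- \<i>) \<Longrightarrow> (\<And>j. j \<in> J \<Longrightarrow> cinner x (g j) = 0) \<Longrightarrow> x = 0"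
    unfolding maximal_def by simp_all
  have f': "f i \<in> eigenvectors \<i>" "N 1 (f i) = f i" "cinner (f i) (f i) = 1" if "i \<in> I" for i
    using that f(1) f(2)[of i i] by (auto simp: eigenvectors_def)
  have g': "g j \<in> eigenvectors (- \<i>)" "N 1 (g j) = g j" "cinner (g j) (g j) = 1" if "j \<in> J" for j
    using that g(1) g(2)[of j j] by (auto simp: eigenvectors_def)

  have shift_id: "\<phi>0 (shift h x) = 0" "\<phi>1 (shift h x) = shift h x"
    if "N 1 h = h" "cinner h h = 1" for h x
  proof -
    have \<psi>1: "\<psi> id_blinfun (shift h x) = shift h x"
      using \<psi>_id_shift[OF that] by (metis blinfun_apply_blinfun_compose)
    have "\<phi>0 (\<psi> id_blinfun (shift h x)) = 0"
      by (simp add: \<psi>_apply \<phi>1_def[symmetric] blinfun.diff_right idem)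
    then show "\<phi>0 (shift h x) = 0" by (simp add: \<psi>1)
    then show "\<phi>1 (shift h x) = shift h x"
      using \<psi>1 by (simp add: \<psi>_apply \<phi>1_def)
  qed
  have shift_f: "\<phi> A (shift (f i) x) = shift (f i) (A x)" if "A \<in> BH" "i \<in> I" for A i x
  proof -
    have "\<psi> A o\<^sub>L shift (f i) = shift (f i) o\<^sub>L A"
      using that by (intro shift_intertwines[OF f'(1,3)]) (auto simp: complex_eq_iff)
    then have "\<psi> A (shift (f i) x) = shift (f i) (A x)"
      by (metis blinfun_apply_blinfun_compose)
    then show ?thesis using shift_id(1)[OF f'(2,3)[OF that(2)]] by (simp add: \<psi>_apply)
  qed
  have shift_g: "\<phi> A (shift (g j) x) = shift (g j) (transp e (adj A) x)" if "A \<in> BH" "j \<in> J" for A j x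
  proof -
    have "\<psi> A o\<^sub>L shift (g j) = shift (g j) o\<^sub>L transp e (adj A)"
      using that
      by (intro shift_intertwines[OF g'(1,3)]) (auto simp: transp_adj_matrix complex_eq_iff)
    then have "\<psi> A (shift (g j) x) = shift (g j) (transp e (adj A) x)"
      by (metis blinfun_apply_blinfun_compose)
    then show ?thesis using shift_id(1)[OF g'(2,3)[OF that(2)]] by (simp add: \<psi>_apply)
  qed

  \<comment> \<open>On the zero and identity blocks the partial isometry is the projection onto the summand and not the identity,
    since its adjoint has to map into the summand.\<close>
  define T where "T b = (case b of Zero_Block \<Rightarrow> id_blinfun - \<phi>1 | Id_Block \<Rightarrow> \<phi>0
    | Op_Block i \<Rightarrow> shift (f i) | Adj_Transp_Block j \<Rightarrow> shift (g j))" for b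
  let ?X = "blocks I J" and ?K = "block_space K0 K1"
  have T_simps [simp]: "T Zero_Block = id_blinfun - \<phi>1" "T Id_Block = \<phi>0"
    "T (Op_Block i) = shift (f i)" "T (Adj_Transp_Block j) = shift (g j)" for i j
    by (simp_all add: T_def)
  have X_simps [simp]: "Zero_Block \<in> ?X" "Id_Block \<in> ?X"
    "Op_Block i \<in> ?X \<longleftrightarrow> i \<in> I" "Adj_Transp_Block j \<in> ?X \<longleftrightarrow> j \<in> J" for i j
    by (auto simp: blocks_def)
  have T_K: "T Zero_Block x = x" if "x \<in> K0" for x
    using that by (simp add: K0_def blinfun.diff_left)
  have T_K1: "\<phi>0 x = x" if "x \<in> K1" for x
    using that by (simp add: K1_def)
  have \<phi>1_K0: "cinner x (\<phi>1 y) = 0" if "x \<in> K0" for x y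
    using that cinner_adj[of \<phi>1 x y] by (simp add: adj01 K0_def)
  have \<phi>0_shift: "cinner (\<phi>0 x) (shift h y) = 0" if "N 1 h = h" "cinner h h = 1" for x y h
    by (simp add: cinner_adj adj01 shift_id(1)[OF that])

  have T_BH: "T b \<in> BH" if "b \<in> ?X" for b
    using that by (cases b) (auto intro!: shift_BH f' g')
  have adj_T: "adj (T b) y \<in> ?K b" if "b \<in> ?X" for b y
    using that
    by (cases b) (simp_all add: K0_def K1_def adj_diff adj01 blinfun.diff_left blinfun.diff_right idem)
  have isometric: "cinner (T b x) (T b y) = cinner x y" if "b \<in> ?X" "x \<in> ?K b" "y \<in> ?K b" for b x y
    using that
    by (cases b) (auto simp: T_K T_K1 shift_isometry[OF f'(2,3)] shift_isometry[OF g'(2,3)] simp del: T_simps(1))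
  have orth: "cinner (T b x) (T b' y) = 0 \<and> cinner (T b' y) (T b x) = 0"
    if "b \<in> ?X" "b' \<in> ?X" "b \<noteq> b'" "x \<in> ?K b" "y \<in> ?K b'" for b b' x y
  proof -
    have K0: "cinner (T Zero_Block x) z = 0 \<and> cinner z (T Zero_Block x) = 0"
      if "x \<in> K0" "\<phi>1 z = z" for x z
      using \<phi>1_K0[OF that(1), of z] that T_K cinner_eq_0_commute by metis
    have K1: "cinner (\<phi>0 x) (shift h y) = 0 \<and> cinner (shift h y) (\<phi>0 x) = 0"
      if "N 1 h = h" "cinner h h = 1" for x y h
      using \<phi>0_shift[OF that] cinner_eq_0_commute by metis
    have fg: "cinner (shift (f i) x) (shift (g j) y) = 0 \<and> cinner (shift (g j) y) (shift (f i) x) = 0"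
      if "i \<in> I" "j \<in> J" for i j x y
      using shift_orthogonal[OF f'(2,3)[OF that(1)] g'(2,3)[OF that(2)]
          eigenvectors_orthogonal[OF f'(1)[OF that(1)] g'(1)[OF that(2)]]] cinner_eq_0_commute by metis
    have ff: "cinner (shift (f i) x) (shift (f j) y) = 0" if "i \<in> I" "j \<in> I" "i \<noteq> j" for i j x y
      using that f(2)[of i j] by (intro shift_orthogonal f') auto
    have gg: "cinner (shift (g i) x) (shift (g j) y) = 0" if "i \<in> J" "j \<in> J" "i \<noteq> j" for i j x y
      using that g(2)[of i j] by (intro shift_orthogonal g') auto
    show ?thesis
      using that
      by (cases b; cases b')
        (auto simp: K0 K1 fg ff gg idem shift_id f' g' simp del: T_simps(1))
  qed
  have total: "y = 0" if y: "\<And>b. b \<in> ?X \<Longrightarrow> adj (T b) y = 0" for y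
  proof (rule \<psi>_separating[where S = "f ` I" and S' = "g ` J"])
    show "f ` I \<subseteq> eigenvectors \<i>" "g ` J \<subseteq> eigenvectors (- \<i>)" by fact+
    show "x = 0" if "x \<in> eigenvectors \<i>" "\<And>s. s \<in> f ` I \<Longrightarrow> cinner x s = 0" for x
      using f(3) that by auto
    show "x = 0" if "x \<in> eigenvectors (- \<i>)" "\<And>s. s \<in> g ` J \<Longrightarrow> cinner x s = 0" for x
      using g(3) that by auto
    show "\<psi> id_blinfun y = y"
      using y[of Zero_Block] y[of Id_Block]
      by (simp add: \<psi>_apply adj_diff adj01 blinfun.diff_left \<phi>1_def[symmetric])
    have "cinner y (shift h x) = 0" if "adj (shift h) y = 0" "N 1 h = h" "cinner h h = 1" for h x
      using cinner_adj'[OF shift_BH[OF that(2,3)], of y x] that(1) by simp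
    then have "cinner y (\<psi> (E i 0) h) = 0" if "adj (shift h) y = 0" "N 1 h = h" "cinner h h = 1" for h i
      using shift_e[OF that(2,3)] that by metis
    then show "cinner y (\<psi> (E i 0) s) = 0" if "s \<in> f ` I \<union> g ` J" for s i
      using that y[of "Op_Block _"] y[of "Adj_Transp_Block _"] f' g' by auto
  qed
  have K_subspace: "csubspace (?K b)" if "b \<in> ?X" for b
    using K by (cases b) (simp_all add: complex_vector.subspace_UNIV)
  note sum = K_subspace T_BH adj_T isometric conjunct1[OF orth] total
  have "hsum_unitary ?X ?K (assemble ?X T)"
    by (rule hsum_unitary_assemble[where X = ?X and K = ?K and T = T, OF sum])
  moreover have "\<phi> A y = assemble ?X T (block_diag e A (hsum_adj ?X ?K (assemble ?X T) y))"
    if A: "A \<in> BH" for A y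
  proof -
    have act: "\<phi> A (T b (block_components ?X T y b)) = T b (block_diag e A (block_components ?X T y) b)"
      if b: "b \<in> ?X" for b
    proof (cases b)
      case Zero_Block
      then show ?thesis
        using \<phi>\<phi>1[OF A] by (simp add: block_diag_def blinfun.diff_left blinfun.diff_right)
    qed (use b A in \<open>simp_all add: block_diag_def \<phi>\<phi>0 shift_f shift_g\<close>)
    have "hsum_adj ?X ?K (assemble ?X T) y = block_components ?X T y"
      by (rule hsum_adj_assemble[where X = ?X and K = ?K and T = T, OF sum])
    then show ?thesis
      by (simp only:) (rule assemble_block_action[where X = ?X and K = ?K and T = T, OF sum act])
  qed
  ultimately show ?thesis
    using K by blast
qed

end
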